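(* Let $G$ be a finitely generated group of subexponential growth, let $\Gamma=(V,E)$ be a $G$-periodic graph, let $D$ be the discrete Laplacian $\Delta$ on $\Gamma$ or, more generally, any linear periodic operator of finite order on $\ell^2(V)$, and let $\lambda$ be an eigenvalue of $D$. Put $R=\mathbb{C}G$ and let $K$ be the $R$-module of all finitely supported $f:V\to\mathbb{C}$ with $Df=\lambda f$. If $K$ admits a finite resolution by finitely generated free $R$-modules $$0\to R^{r_d}\to R^{r_{d-1}}\to\cdots\to R^{r_1}\to R^{r_0}\to K\to 0,$$ then $$\nu(\{\lambda\})=\frac{1}{|\Gamma/G|}\sum_{k=0}^{d}(-1)^k r_k,$$ where $|\Gamma/G|=|V/G|$ is the number of orbits of $G$ on $V$.
   Context: Graphs are simple, undirected and locally finite. For a finitely generated group $G$, a $G$-periodic graph is a graph $\Gamma=(V,E)$ with a free action of $G$ on $V$ having finitely many orbits and preserving edges: $(u,v)\in E\Rightarrow (g\cdot u,g\cdot v)\in E$. A fundamental domain $W\subset V$ is a (finite) set containing exactly one vertex from each orbit. $G$ has subexponential growth if for some (equivalently every) finite generating set $S$ the function $n\mapsto|\{g\in G:|g|_S\le n\}|$ grows subexponentially, where $|g|_S$ is the word length of $g$ (distance from $1$ in the Cayley graph). For $g\in G$ and $f:V\to\mathbb{C}$ put $(\pi_g f)(v)=f(g^{-1}\cdot v)$. An operator $D$ on $\ell^2(V)$ is periodic if $\pi_gD=D\pi_g$ for all $g\in G$. It has finite order $r\in\mathbb{N}$ if for all $f,h\in\ell^2(V)$ and $v\in V$: whenever $f(w)=h(w)$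 for all $w$ with $d(w,v)<r$, then $Df(v)=Dh(v)$; here $d$ is the path distance in $\Gamma$ ($\infty$ if there is no path). The discrete Laplacian is $$\Delta f(v)=\frac{1}{\sqrt{\deg v}}\sum_{w\sim v}\Bigl(\frac{f(w)}{\sqrt{\deg w}}-\frac{f(v)}{\sqrt{\deg v}}\Bigr);$$ it is periodic and of finite order. An eigenvalue of $D$ is a $\lambda$ such that $D-\lambda I$ is not injective on $\ell^2(V)$. The space $K$ of finitely supported eigenfunctions is a (left) module over the group algebra $\mathbb{C}G$ through the linear extension of $g\cdot f=\pi_g f$. Density of states: fix a fundamental domain $W$. Then $\nu(\{\lambda\})=\frac1{|W|}\operatorname{tr}(E(\{\lambda\})I_W)$, where $E(\{\lambda\})$ is the orthogonal projection of $\ell^2(V)$ onto the eigenspace $\{f\in\ell^2(V):Df=\lambda f\}$ and $I_W$ is the projection onto functions supported on $W$. *)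

theory Defs
  imports
    "HOL-Analysis.Infinite_Sum"
    "HOL-Library.Landau_Symbols"
    "HOL-Library.Extended_Nat"
    "HOL-Algebra.Generated_Groups"
    "HOL-Algebra.Group_Action"
    "HOL-Algebra.Module"
begin

section \<open>Growth of finitely generated groups\<close>

definition finitely_generated :: "('g, 'm) monoid_scheme \<Rightarrow> bool" where
  "finitely_generated G \<longleftrightarrow>
     (\<exists>S. finite S \<and> S \<subseteq> carrier G \<and> generate G S = carrier G)"

text \<open>The length of a shortest word in \<open>S\<close> and the inverses of \<open>S\<close>, that is, the distance
  from \<open>\<one>\<close> in the (undirected) Cayley graph. It is only used for generating sets, for which such
  a word exists.\<close>

definition word_length :: "('g, 'm) monoid_scheme \<Rightarrow> 'g set \<Rightarrow> 'g \<Rightarrow> nat" where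
  "word_length G S g =
     (LEAST n. \<exists>xs. length xs = n \<and> set xs \<subseteq> S \<union> (\<lambda>s. inv\<^bsub>G\<^esub> s) ` S \<and>
                 g = foldr (\<lambda>x y. x \<otimes>\<^bsub>G\<^esub> y) xs \<one>\<^bsub>G\<^esub>)"

definition growth :: "('g, 'm) monoid_scheme \<Rightarrow> 'g set \<Rightarrow> nat \<Rightarrow> nat" where
  "growth G S n = card {g \<in> carrier G. word_length G S g \<le> n}"

definition subexponential_growth :: "('g, 'm) monoid_scheme \<Rightarrow> bool" where
  "subexponential_growth G \<longleftrightarrow>
     (\<exists>S. finite S \<and> S \<subseteq> carrier G \<and> generate G S = carrier G \<and>
        (\<forall>c::real. c > 1 \<longrightarrow> (\<lambda>n. real (growth G S n)) \<in> o(\<lambda>n. c ^ n)))"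


section \<open>Periodic graphs\<close>

text \<open>A simple undirected graph is given by its vertex set and its (irreflexive, symmetric)
  adjacency relation; \<open>E `` {v}\<close> is the set of neighbours of \<open>v\<close>.\<close>

locale periodic_graph = group_action G V \<phi>
  for G :: "('g, 'm) monoid_scheme" (structure)
    and V :: "'v set" and \<phi> :: "'g \<Rightarrow> 'v \<Rightarrow> 'v" +
  fixes E :: "('v \<times> 'v) set"
  assumes edges_in: "E \<subseteq> V \<times> V"
    and undirected: "sym E"
    and loopfree: "irrefl E"
    and locally_finite: "\<And>v. v \<in> V \<Longrightarrow> finite (E `` {v})"
    and free_action: "\<And>g v. g \<in> carrier G \<Longrightarrow> v \<in> V \<Longrightarrow> \<phi> g v = v \<Longrightarrow> g = \<one>"
    and finitely_many_orbits: "finite (orbits G V \<phi>)"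
    and edges_preserved:
      "\<And>g u v. g \<in> carrier G \<Longrightarrow> (u, v) \<in> E \<Longrightarrow> (\<phi> g u, \<phi> g v) \<in> E"

definition fundamental_domain ::
    "('g, 'm) monoid_scheme \<Rightarrow> 'v set \<Rightarrow> ('g \<Rightarrow> 'v \<Rightarrow> 'v) \<Rightarrow> 'v set \<Rightarrow> bool" where
  "fundamental_domain G V \<phi> W \<longleftrightarrow> W \<subseteq> V \<and> (\<forall>Q \<in> orbits G V \<phi>. \<exists>!w. w \<in> W \<inter> Q)"

text \<open>\<open>(u, v) \<in> E ^^ n\<close> means that there is a walk of length \<open>n\<close> from \<open>u\<close> to \<open>v\<close>; the infimum of
  the empty set is \<open>\<infinity>\<close>.\<close>

definition graph_dist :: "('v \<times> 'v) set \<Rightarrow> 'v \<Rightarrow> 'v \<Rightarrow> enat" where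
  "graph_dist E u v = (INF n \<in> {n. (u, v) \<in> E ^^ n}. enat n)"

definition vertex_degree :: "('v \<times> 'v) set \<Rightarrow> 'v \<Rightarrow> nat" where
  "vertex_degree E v = card (E `` {v})"


section \<open>Operators on the square-summable functions\<close>

text \<open>Functions on \<open>V\<close> are represented by functions on the whole type that vanish outside \<open>V\<close>.\<close>

definition ell2 :: "'v set \<Rightarrow> ('v \<Rightarrow> complex) set" where
  "ell2 V = {f. (\<forall>v. v \<notin> V \<longrightarrow> f v = 0) \<and> (\<lambda>v. (cmod (f v))\<^sup>2) summable_on V}"

definition ell2_inner :: "'v set \<Rightarrow> ('v \<Rightarrow> complex) \<Rightarrow> ('v \<Rightarrow> complex) \<Rightarrow> complex" where
  "ell2_inner V f h = (\<Sum>\<^sub>\<infinity>v\<in>V. cnj (f v) * h v)"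

definition translate ::
    "('g, 'm) monoid_scheme \<Rightarrow> 'v set \<Rightarrow> ('g \<Rightarrow> 'v \<Rightarrow> 'v) \<Rightarrow> 'g \<Rightarrow> ('v \<Rightarrow> complex) \<Rightarrow> 'v \<Rightarrow> complex"
  where
  "translate G V \<phi> g f = (\<lambda>v. if v \<in> V then f (\<phi> (inv\<^bsub>G\<^esub> g) v) else 0)"

definition linear_operator_on_ell2 ::
    "'v set \<Rightarrow> (('v \<Rightarrow> complex) \<Rightarrow> 'v \<Rightarrow> complex) \<Rightarrow> bool" where
  "linear_operator_on_ell2 V D \<longleftrightarrow>
     (\<forall>f \<in> ell2 V. D f \<in> ell2 V) \<and>
     (\<forall>f \<in> ell2 V. \<forall>h \<in> ell2 V. D (\<lambda>v. f v + h v) = (\<lambda>v. D f v + D h v)) \<and>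
     (\<forall>c. \<forall>f \<in> ell2 V. D (\<lambda>v. c * f v) = (\<lambda>v. c * D f v))"

definition periodic_operator ::
    "('g, 'm) monoid_scheme \<Rightarrow> 'v set \<Rightarrow> ('g \<Rightarrow> 'v \<Rightarrow> 'v) \<Rightarrow>
     (('v \<Rightarrow> complex) \<Rightarrow> 'v \<Rightarrow> complex) \<Rightarrow> bool" where
  "periodic_operator G V \<phi> D \<longleftrightarrow>
     (\<forall>g \<in> carrier G. \<forall>f \<in> ell2 V. translate G V \<phi> g (D f) = D (translate G V \<phi> g f))"

definition has_order ::
    "'v set \<Rightarrow> ('v \<times> 'v) set \<Rightarrow> (('v \<Rightarrow> complex) \<Rightarrow> 'v \<Rightarrow> complex) \<Rightarrow> nat \<Rightarrow> bool" where
  "has_order V E D \<rho> \<longleftrightarrow>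
     (\<forall>f \<in> ell2 V. \<forall>h \<in> ell2 V. \<forall>v \<in> V.
        (\<forall>w \<in> V. graph_dist E w v < enat \<rho> \<longrightarrow> f w = h w) \<longrightarrow> D f v = D h v)"

definition finite_order ::
    "'v set \<Rightarrow> ('v \<times> 'v) set \<Rightarrow> (('v \<Rightarrow> complex) \<Rightarrow> 'v \<Rightarrow> complex) \<Rightarrow> bool" where
  "finite_order V E D \<longleftrightarrow> (\<exists>\<rho>. has_order V E D \<rho>)"

text \<open>At an isolated vertex the sum is empty, so the value there is \<open>0\<close>.\<close>

definition discrete_laplacian ::
    "'v set \<Rightarrow> ('v \<times> 'v) set \<Rightarrow> ('v \<Rightarrow> complex) \<Rightarrow> 'v \<Rightarrow> complex" where
  "discrete_laplacian V E f =
     (\<lambda>v. if v \<in> V then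
        1 / complex_of_real (sqrt (real (vertex_degree E v))) *
        (\<Sum>w \<in> E `` {v}. f w / complex_of_real (sqrt (real (vertex_degree E w)))
                        - f v / complex_of_real (sqrt (real (vertex_degree E v))))
      else 0)"

definition is_eigenvalue ::
    "'v set \<Rightarrow> (('v \<Rightarrow> complex) \<Rightarrow> 'v \<Rightarrow> complex) \<Rightarrow> complex \<Rightarrow> bool" where
  "is_eigenvalue V D \<mu> \<longleftrightarrow> \<not> inj_on (\<lambda>f v. D f v - \<mu> * f v) (ell2 V)"

definition eigenspace ::
    "'v set \<Rightarrow> (('v \<Rightarrow> complex) \<Rightarrow> 'v \<Rightarrow> complex) \<Rightarrow> complex \<Rightarrow> ('v \<Rightarrow> complex) set" where
  "eigenspace V D \<mu> = {f \<in> ell2 V. D f = (\<lambda>v. \<mu> * f v)}"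


section \<open>Density of states\<close>

definition orthogonal_projection ::
    "'v set \<Rightarrow> ('v \<Rightarrow> complex) set \<Rightarrow> ('v \<Rightarrow> complex) \<Rightarrow> 'v \<Rightarrow> complex" where
  "orthogonal_projection V M f =
     (THE p. p \<in> M \<and> (\<forall>h \<in> M. ell2_inner V h (\<lambda>v. f v - p v) = 0))"

definition restrict_support :: "'v set \<Rightarrow> ('v \<Rightarrow> complex) \<Rightarrow> 'v \<Rightarrow> complex" where
  "restrict_support W f = (\<lambda>v. if v \<in> W then f v else 0)"

definition point_mass :: "'a \<Rightarrow> 'a \<Rightarrow> complex" where
  "point_mass x = (\<lambda>y. if y = x then 1 else 0)"

definition operator_trace ::
    "'v set \<Rightarrow> (('v \<Rightarrow> complex) \<Rightarrow> 'v \<Rightarrow> complex) \<Rightarrow> complex" where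
  "operator_trace V T = (\<Sum>\<^sub>\<infinity>v\<in>V. ell2_inner V (point_mass v) (T (point_mass v)))"

definition density_of_states_at ::
    "'v set \<Rightarrow> 'v set \<Rightarrow> (('v \<Rightarrow> complex) \<Rightarrow> 'v \<Rightarrow> complex) \<Rightarrow> complex \<Rightarrow> complex" where
  "density_of_states_at V W D \<mu> =
     1 / of_nat (card W) *
     operator_trace V (\<lambda>f. orthogonal_projection V (eigenspace V D \<mu>) (restrict_support W f))"


section \<open>The group algebra and its left modules\<close>

definition group_algebra :: "('g, 'm) monoid_scheme \<Rightarrow> ('g \<Rightarrow> complex) ring" where
  "group_algebra G =
     \<lparr> carrier = {a. finite {g. a g \<noteq> 0} \<and> {g. a g \<noteq> 0} \<subseteq> carrier G},
       mult = (\<lambda>a b g. if g \<in> carrier G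
                        then \<Sum>h | a h \<noteq> 0. a h * b (inv\<^bsub>G\<^esub> h \<otimes>\<^bsub>G\<^esub> g) else 0),
       one = point_mass \<one>\<^bsub>G\<^esub>,
       zero = (\<lambda>_. 0),
       add = (\<lambda>a b g. a g + b g) \<rparr>"

text \<open>The locale \<open>module\<close> of the library requires a commutative ring of scalars. Only its record
  type is used here: \<open>zero\<close>, \<open>add\<close> and \<open>smult\<close> hold the left module structure, and the fields
  \<open>mult\<close> and \<open>one\<close> are irrelevant.\<close>

definition free_left_module :: "('a, 'm) ring_scheme \<Rightarrow> nat \<Rightarrow> ('a, nat \<Rightarrow> 'a) module" where
  "free_left_module R n =
     \<lparr> carrier = {..<n} \<rightarrow>\<^sub>E carrier R,
       mult = undefined, one = undefined,
       zero = (\<lambda>i\<in>{..<n}. \<zero>\<^bsub>R\<^esub>),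
       add = (\<lambda>x y. \<lambda>i\<in>{..<n}. x i \<oplus>\<^bsub>R\<^esub> y i),
       smult = (\<lambda>a x. \<lambda>i\<in>{..<n}. a \<otimes>\<^bsub>R\<^esub> x i) \<rparr>"

definition eigenfunction_module ::
    "('g, 'm) monoid_scheme \<Rightarrow> 'v set \<Rightarrow> ('g \<Rightarrow> 'v \<Rightarrow> 'v) \<Rightarrow>
     (('v \<Rightarrow> complex) \<Rightarrow> 'v \<Rightarrow> complex) \<Rightarrow> complex \<Rightarrow> ('g \<Rightarrow> complex, 'v \<Rightarrow> complex) module" where
  "eigenfunction_module G V \<phi> D \<mu> =
     \<lparr> carrier = {f. finite {v. f v \<noteq> 0} \<and> {v. f v \<noteq> 0} \<subseteq> V \<and> D f = (\<lambda>v. \<mu> * f v)},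
       mult = undefined, one = undefined,
       zero = (\<lambda>_. 0),
       add = (\<lambda>f h v. f v + h v),
       smult = (\<lambda>a f v. \<Sum>g | a g \<noteq> 0. a g * translate G V \<phi> g f v) \<rparr>"

definition left_module_hom ::
    "('a, 'm) ring_scheme \<Rightarrow> ('a, 'x, 'p) module_scheme \<Rightarrow> ('a, 'y, 'q) module_scheme \<Rightarrow>
     ('x \<Rightarrow> 'y) set" where
  "left_module_hom R M N =
     {h. h \<in> carrier M \<rightarrow> carrier N \<and>
         (\<forall>x \<in> carrier M. \<forall>y \<in> carrier M. h (x \<oplus>\<^bsub>M\<^esub> y) = h x \<oplus>\<^bsub>N\<^esub> h y) \<and>
         (\<forall>a \<in> carrier R. \<forall>x \<in> carrier M. h (a \<odot>\<^bsub>M\<^esub> x) = a \<odot>\<^bsub>N\<^esub> h x)}"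

definition mod_kernel ::
    "('a, 'x, 'p) module_scheme \<Rightarrow> ('a, 'y, 'q) module_scheme \<Rightarrow> ('x \<Rightarrow> 'y) \<Rightarrow> 'x set" where
  "mod_kernel M N h = {x \<in> carrier M. h x = \<zero>\<^bsub>N\<^esub>}"

text \<open>Exactness of \<open>0 \<rightarrow> R\<^bsup>r d\<^esup> \<rightarrow> \<dots> \<rightarrow> R\<^bsup>r 0\<^esup> \<rightarrow> M \<rightarrow> 0\<close>, where \<open>\<delta> k\<close> is the map
  from \<open>R\<^bsup>r (k + 1)\<^esup>\<close> to \<open>R\<^bsup>r k\<^esup>\<close> for \<open>k < d\<close>. The map arriving at \<open>R\<^bsup>r d\<^esup>\<close>
  is \<open>0\<close>, and \<open>incoming k\<close> is the image of the map arriving at \<open>R\<^bsup>r k\<^esup>\<close>.\<close>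

definition finite_free_resolution ::
    "('a, 'm) ring_scheme \<Rightarrow> ('a, 'x, 'p) module_scheme \<Rightarrow> nat \<Rightarrow> (nat \<Rightarrow> nat) \<Rightarrow>
     ((nat \<Rightarrow> 'a) \<Rightarrow> 'x) \<Rightarrow> (nat \<Rightarrow> (nat \<Rightarrow> 'a) \<Rightarrow> nat \<Rightarrow> 'a) \<Rightarrow> bool" where
  "finite_free_resolution R M d r \<epsilon> \<delta> \<longleftrightarrow>
     (let F = (\<lambda>k. free_left_module R (r k));
          incoming = (\<lambda>k. if k < d then \<delta> k ` carrier (F (Suc k)) else {\<zero>\<^bsub>F k\<^esub>})
      in \<epsilon> \<in> left_module_hom R (F 0) M \<and>
         (\<forall>k<d. \<delta> k \<in> left_module_hom R (F (Suc k)) (F k)) \<and>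
         \<epsilon> ` carrier (F 0) = carrier M \<and>
         mod_kernel (F 0) M \<epsilon> = incoming 0 \<and>
         (\<forall>k<d. mod_kernel (F (Suc k)) (F k) (\<delta> k) = incoming (Suc k)))"

end

theory Submission
  imports Defs "HOL-Library.Function_Algebras"
begin

text \<open>Let \<open>B n\<close> be the ball of radius \<open>n\<close> in the group. Subexponential growth provides, for each
  fixed \<open>m\<close>, radii \<open>n\<close> for which \<open>|B (n + m)| - |B n|\<close> is small relative to \<open>|B n|\<close>; write
  \<open>\<approx>\<close> for equality up to a multiple of this difference. Let \<open>K\<^sub>n\<close> be the space of
  eigenfunctions supported in \<open>B n W\<close>.

  The trace of the spectral projection over the box \<open>B n W\<close> is \<open>|B n|\<close> times its trace over \<open>W\<close>.
  It is at least \<open>dim K\<^sub>n\<close>, by Bessel's inequality, and at most the dimension of the space of restrictions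
  of \<open>\<ell>\<^sup>2\<close>-eigenfunctions to the box; as an eigenfunction that vanishes on the thick boundary can be
  cut off, that dimension is \<open>\<approx> dim K\<^sub>n\<close>.

  A map \<open>T\<close> in the resolution commutes with translations, so it moves supports by a bounded amount.
  Rank-nullity in the boxes gives
  \<open>dim (im T)\<^sub>n + dim (ker T)\<^sub>n \<approx> rank \<sqdot> |B n|\<close>, with the rank of the source of \<open>T\<close>, and the
  alternating sum over the resolution is \<open>dim K\<^sub>n \<approx> (\<Sum>k. (-1)\<^sup>k r\<^sub>k) |B n|\<close>.\<close>

section \<open>Linear algebra\<close>

context vector_space begin

lemma dim_subset_finite_span:
  assumes "S \<subseteq> T" "T \<subseteq> span F" "finite F"
  shows "dim S \<le> dim T"
proof -
  obtain B where B: "B \<subseteq> S" "independent B" "card B = dim S"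
    by (rule basis_exists)
  obtain C where C: "C \<subseteq> T" "independent C" "T \<subseteq> span C" "card C = dim T"
    by (rule basis_exists)
  have "finite C" using independent_span_bound[OF \<open>finite F\<close> C(2)] C assms by blast
  then show ?thesis using independent_span_bound[OF _ B(2), of C] B C assms by auto
qed

end

lemma (in vector_space_pair) rank_nullity_on:
  assumes U: "vs1.subspace U" "U \<subseteq> vs1.span F" "finite F"
    and add: "\<And>x y. x \<in> U \<Longrightarrow> y \<in> U \<Longrightarrow> T (x + y) = T x + T y"
    and scale: "\<And>c x. x \<in> U \<Longrightarrow> T (s1 c x) = s2 c (T x)"
  shows "vs2.dim (T ` U) + vs1.dim {x \<in> U. T x = 0} = vs1.dim U"
proof -
  have T0: "T 0 = 0" using scale[of 0 0] vs1.subspace_0[OF U(1)] by simp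
  let ?K = "{x \<in> U. T x = 0}"
  have subK: "vs1.subspace ?K"
    using U(1) add scale T0 by (simp add: vs1.subspace_def)
  obtain B where B: "B \<subseteq> ?K" "vs1.independent B" "?K \<subseteq> vs1.span B" "card B = vs1.dim ?K"
    by (rule vs1.basis_exists)
  obtain C where C: "B \<subseteq> C" "C \<subseteq> U" "vs1.independent C" "U \<subseteq> vs1.span C"
    using vs1.maximal_independent_subset_extend[of B U] B by auto
  have finC: "finite C" using vs1.independent_span_bound[OF U(3) C(3)] C U by blast
  have cardC: "card C = vs1.dim U" using vs1.basis_card_eq_dim[OF C(2,4,3)] .
  define L where "L = construct C T"
  have linL: "Vector_Spaces.linear s1 s2 L" unfolding L_def by (rule linear_construct[OF C(3)])
  have spanC: "vs1.span C = U" using C U by (simp add: vs1.span_subspace)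
  have LT: "L x = T x" if "x \<in> U" for x
  proof -
    have "vs1.subspace {x \<in> U. L x = T x}"
      using U(1) add scale T0 linear_add[OF linL] linear_scale[OF linL] linear_0[OF linL]
      by (simp add: vs1.subspace_def)
    moreover have "C \<subseteq> {x \<in> U. L x = T x}"
      using C construct_basis[OF C(3)] by (auto simp: L_def)
    ultimately have "vs1.span C \<subseteq> {x \<in> U. L x = T x}" by (rule vs1.span_minimal[rotated])
    then show ?thesis using that spanC by auto
  qed
  have inj: "inj_on L (vs1.span (C - B))"
  proof (subst linear_inj_on_iff_eq_0[OF linL vs1.subspace_span], intro ballI impI)
    fix x assume x: "x \<in> vs1.span (C - B)" "L x = 0"
    then have "x \<in> U" using vs1.span_mono[of "C - B" C] spanC by blast
    then have xB: "x \<in> vs1.span B" using x LT B by auto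
    have "vs1.representation C x = vs1.representation B x"
      and "vs1.representation C x = vs1.representation (C - B) x"
      using vs1.representation_extend[OF C(3)] xB x(1) C(1) by (metis Diff_subset)+
    then have "vs1.representation C x b = 0" for b
      using vs1.representation_ne_zero[of B x b] vs1.representation_ne_zero[of "C - B" x b] by auto
    then show "x = 0"
      using vs1.sum_nonzero_representation_eq[OF C(3), of x] spanC \<open>x \<in> U\<close> by simp
  qed
  have ind: "vs2.independent (L ` (C - B))"
    using linear_independent_injective_image[OF linL _ inj] C(3) vs1.independent_mono by blast
  have sp: "T ` U \<subseteq> vs2.span (L ` (C - B))"
  proof
    fix y assume "y \<in> T ` U"
    then obtain x where x: "x \<in> vs1.span C" "y = L x" using spanC LT by auto
    then have "y \<in> vs2.span (L ` C)" using linear_span_image[OF linL, of C] by auto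
    moreover have "L ` C \<subseteq> insert 0 (L ` (C - B))"
      using B(1) LT by auto
    ultimately show "y \<in> vs2.span (L ` (C - B))"
      using vs2.span_mono[of "L ` C" "insert 0 (L ` (C - B))"] by auto
  qed
  have "vs2.dim (T ` U) = card (L ` (C - B))"
    by (rule vs2.basis_card_eq_dim[symmetric, OF _ sp ind]) (use C LT in auto)
  also have "\<dots> = card (C - B)"
    by (rule card_image) (meson inj inj_on_subset vs1.span_superset)
  also have "\<dots> = card C - card B" using C finC by (simp add: card_Diff_subset finite_subset)
  finally show ?thesis using cardC B(4) card_mono[OF finC C(1)] by simp
qed


section \<open>Finitely supported functions\<close>

definition cscale :: "complex \<Rightarrow> ('a \<Rightarrow> complex) \<Rightarrow> 'a \<Rightarrow> complex" where
  "cscale c f = (\<lambda>x. c * f x)"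

lemma cscale_apply [simp]: "cscale c f x = c * f x"
  by (simp add: cscale_def)

interpretation cfun: vector_space cscale
  by unfold_locales (auto simp: fun_eq_iff algebra_simps)

interpretation cfun2: vector_space_pair cscale cscale ..

definition fun_on :: "'a set \<Rightarrow> ('a \<Rightarrow> complex) set" where
  "fun_on A = {f. \<forall>x. x \<notin> A \<longrightarrow> f x = 0}"

lemma fun_onD: "f \<in> fun_on A \<Longrightarrow> x \<notin> A \<Longrightarrow> f x = 0"
  by (simp add: fun_on_def)

lemma fun_on_mono: "A \<subseteq> B \<Longrightarrow> fun_on A \<subseteq> fun_on B"
  by (auto simp: fun_on_def)

lemma subspace_fun_on: "cfun.subspace (fun_on A)"
  by (rule cfun.subspaceI) (auto simp: fun_on_def)

lemma point_mass_fun_on: "x \<in> A \<Longrightarrow> point_mass x \<in> fun_on A"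
  by (auto simp: fun_on_def point_mass_def)

lemma restrict_support_fun_on: "restrict_support A f \<in> fun_on A"
  by (simp add: fun_on_def restrict_support_def)

lemma restrict_support_idem: "f \<in> fun_on A \<Longrightarrow> restrict_support A f = f"
  by (auto simp: fun_on_def restrict_support_def)

lemma sum_cscale_apply: "(\<Sum>i\<in>I. cscale (c i) (e i)) x = (\<Sum>i\<in>I. c i * e i x)"
  by (induction I rule: infinite_finite_induct) simp_all

lemma fun_on_expand:
  assumes "finite A" "f \<in> fun_on A"
  shows "f = (\<Sum>x\<in>A. cscale (f x) (point_mass x))"
proof
  fix y
  have "(\<Sum>x\<in>A. cscale (f x) (point_mass x)) y = (\<Sum>x\<in>A. f x * (if y = x then 1 else 0))"
    unfolding sum_cscale_apply by (simp add: point_mass_def)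
  also have "\<dots> = f y" using assms by (simp add: fun_on_def if_distrib sum.delta cong: if_cong)
  finally show "f y = (\<Sum>x\<in>A. cscale (f x) (point_mass x)) y" by simp
qed

lemma fun_on_subset_span:
  assumes "finite A"
  shows "fun_on A \<subseteq> cfun.span (point_mass ` A)"
proof
  fix f :: "'a \<Rightarrow> complex" assume "f \<in> fun_on A"
  then have "f = (\<Sum>x\<in>A. cscale (f x) (point_mass x))" by (rule fun_on_expand[OF assms])
  also have "\<dots> \<in> cfun.span (point_mass ` A)"
    by (intro cfun.span_sum cfun.span_scale cfun.span_base) auto
  finally show "f \<in> cfun.span (point_mass ` A)" .
qed

lemma dim_mono:
  "S \<subseteq> U \<Longrightarrow> U \<subseteq> fun_on A \<Longrightarrow> finite A \<Longrightarrow> cfun.dim S \<le> cfun.dim U"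
  by (meson cfun.dim_subset_finite_span finite_imageI fun_on_subset_span order_trans)

lemma dim_fun_on:
  assumes "finite A"
  shows "cfun.dim (fun_on A) = card A"
proof -
  have "cfun.independent (point_mass ` A)"
    using assms
  proof (induction A)
    case (insert a A)
    have "cfun.span (point_mass ` A) \<subseteq> fun_on A"
      by (rule cfun.span_minimal) (auto simp: subspace_fun_on point_mass_fun_on)
    then have "point_mass a \<notin> cfun.span (point_mass ` A)"
      using insert.hyps fun_onD[of "point_mass a" A a] by (auto simp: point_mass_def)
    then show ?case
      unfolding image_insert using insert.IH by (rule cfun.independent_insertI)
  qed (unfold image_empty, rule cfun.independent_empty)
  moreover have "card (point_mass ` A) = card A"
    by (rule card_image) (auto simp: inj_on_def point_mass_def fun_eq_iff split: if_splits)
  ultimately show ?thesis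
    using cfun.basis_card_eq_dim[of "point_mass ` A" "fun_on A"] fun_on_subset_span[OF assms]
      image_subsetI[of A point_mass "fun_on A", OF point_mass_fun_on] by simp
qed

lemma dim_le_card: "U \<subseteq> fun_on A \<Longrightarrow> finite A \<Longrightarrow> cfun.dim U \<le> card A"
  using dim_mono[of U "fun_on A" A] dim_fun_on[of A] by simp

lemma rank_nullity:
  fixes T :: "('a \<Rightarrow> complex) \<Rightarrow> 'b \<Rightarrow> complex"
  assumes "cfun.subspace U" "U \<subseteq> fun_on A" "finite A"
    and "\<And>x y. x \<in> U \<Longrightarrow> y \<in> U \<Longrightarrow> T (x + y) = T x + T y"
    and "\<And>c x. x \<in> U \<Longrightarrow> T (cscale c x) = cscale c (T x)"
  shows "cfun.dim (T ` U) + cfun.dim {x \<in> U. T x = 0} = cfun.dim U"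
  by (rule cfun2.rank_nullity_on[where F = "point_mass ` A"])
    (use assms fun_on_subset_span[of A] in auto)

lemma subspace_restrict:
  assumes "cfun.subspace H"
  shows "cfun.subspace (restrict_support Q ` H)"
proof -
  have radd: "restrict_support Q x + restrict_support Q y = restrict_support Q (x + y)" for x y
    by (auto simp: restrict_support_def fun_eq_iff)
  have rscale: "cscale c (restrict_support Q x) = restrict_support Q (cscale c x)" for c x
    by (auto simp: restrict_support_def fun_eq_iff)
  have "0 = restrict_support Q 0" by (auto simp: restrict_support_def fun_eq_iff)
  then show ?thesis
    using cfun.subspace_add[OF assms] cfun.subspace_scale[OF assms] cfun.subspace_0[OF assms]
    unfolding cfun.subspace_def by (auto simp del: plus_fun_apply cscale_apply simp: radd rscale)
qed

lemma dim_le_dim_Int_fun_on: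
  assumes "cfun.subspace U" "U \<subseteq> fun_on B" "finite B"
  shows "cfun.dim U \<le> cfun.dim (U \<inter> fun_on A) + card (B - A)"
proof -
  have "cfun.dim (restrict_support (B - A) ` U) + cfun.dim {f \<in> U. restrict_support (B - A) f = 0}
      = cfun.dim U"
    by (rule rank_nullity[OF assms]) (auto simp: restrict_support_def fun_eq_iff)
  moreover have "{f \<in> U. restrict_support (B - A) f = 0} = U \<inter> fun_on A"
    using assms(2) by (auto simp: restrict_support_def fun_eq_iff fun_on_def split: if_splits)
  moreover have "cfun.dim (restrict_support (B - A) ` U) \<le> card (B - A)"
    by (rule dim_le_card) (use assms restrict_support_fun_on in auto)
  ultimately show ?thesis by simp
qed

section \<open>Square-summable functions\<close>

lemma ell2_outside: "f \<in> ell2 V \<Longrightarrow> v \<notin> V \<Longrightarrow> f v = 0"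
  by (simp add: ell2_def)

lemma ell2_cmult_summable:
  assumes "f \<in> ell2 V" "h \<in> ell2 V"
  shows "(\<lambda>v. cnj (f v) * h v) summable_on V"
proof -
  have s: "(\<lambda>v. (cmod (f v))\<^sup>2 + (cmod (h v))\<^sup>2) summable_on V"
    by (intro summable_on_add) (use assms in \<open>auto simp: ell2_def\<close>)
  have "cmod (cnj (f v) * h v) \<le> (cmod (f v))\<^sup>2 + (cmod (h v))\<^sup>2" for v
  proof -
    have "0 \<le> cmod (f v) * cmod (h v)" by simp
    then show ?thesis
      using sum_squares_bound[of "cmod (f v)" "cmod (h v)"] by (simp only: norm_mult
          complex_mod_cnj)
  qed
  then have "(\<lambda>v. cnj (f v) * h v) abs_summable_on V"
    by (intro summable_on_comparison_test[OF s]) auto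
  then show ?thesis by (rule abs_summable_summable)
qed

lemma ell2_add:
  assumes "f \<in> ell2 V" "h \<in> ell2 V"
  shows "f + h \<in> ell2 V"
proof -
  have s: "(\<lambda>v. 2 * (cmod (f v))\<^sup>2 + 2 * (cmod (h v))\<^sup>2) summable_on V"
    by (intro summable_on_add summable_on_cmult_right) (use assms in \<open>auto simp: ell2_def\<close>)
  have "(cmod (f v + h v))\<^sup>2 \<le> 2 * (cmod (f v))\<^sup>2 + 2 * (cmod (h v))\<^sup>2" for v
  proof -
    have "(cmod (f v + h v))\<^sup>2 \<le> (cmod (f v) + cmod (h v))\<^sup>2"
      by (intro power_mono norm_triangle_ineq) auto
    also have "\<dots> \<le> 2 * (cmod (f v))\<^sup>2 + 2 * (cmod (h v))\<^sup>2"
      using sum_squares_bound[of "cmod (f v)" "cmod (h v)"] by (simp add: power2_sum)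
    finally show ?thesis .
  qed
  then have "(\<lambda>v. (cmod (f v + h v))\<^sup>2) summable_on V"
    by (intro summable_on_comparison_test[OF s]) auto
  then show ?thesis using assms by (auto simp: ell2_def)
qed

lemma ell2_scale: "f \<in> ell2 V \<Longrightarrow> cscale c f \<in> ell2 V"
  by (auto simp: ell2_def norm_mult power_mult_distrib intro: summable_on_cmult_right)

lemma subspace_ell2: "cfun.subspace (ell2 V)"
  by (rule cfun.subspaceI) (auto simp: ell2_add ell2_scale, simp add: ell2_def)

lemma ell2_diff: "f \<in> ell2 V \<Longrightarrow> h \<in> ell2 V \<Longrightarrow> f - h \<in> ell2 V"
  by (rule cfun.subspace_diff[OF subspace_ell2])

lemma fun_on_ell2:
  assumes "finite A" "A \<subseteq> V"
  shows "fun_on A \<subseteq> ell2 V"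
proof
  fix f :: "'a \<Rightarrow> complex" assume f: "f \<in> fun_on A"
  have "(\<lambda>v. (cmod (f v))\<^sup>2) summable_on A" using assms by simp
  then have "(\<lambda>v. (cmod (f v))\<^sup>2) summable_on V"
    by (rule summable_on_cong_neutral[THEN iffD1, rotated -1]) (use f assms in \<open>auto simp:
        fun_on_def\<close>)
  then show "f \<in> ell2 V" using f assms by (auto simp: ell2_def fun_on_def)
qed

lemma ell2_inner_fun_on:
  assumes "f \<in> fun_on A" "A \<subseteq> V"
  shows "ell2_inner V f h = ell2_inner A f h"
  unfolding ell2_inner_def by (rule infsum_cong_neutral) (use assms in \<open>auto simp: fun_on_def\<close>)

lemma ell2_inner_point_mass_left: "v \<in> V \<Longrightarrow> ell2_inner V (point_mass v) f = f v"
  by (subst ell2_inner_fun_on[of _ "{v}"], rule point_mass_fun_on)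
    (auto simp: ell2_inner_def point_mass_def)

lemma ell2_inner_commute: "ell2_inner V h f = cnj (ell2_inner V f h)"
  unfolding ell2_inner_def infsum_cnj[symmetric] by (simp add: mult.commute)

lemma ell2_inner_point_mass_right: "v \<in> V \<Longrightarrow> ell2_inner V f (point_mass v) = cnj (f v)"
  by (simp add: ell2_inner_commute[of V f] ell2_inner_point_mass_left)

lemma ell2_inner_add_right:
  assumes "f \<in> ell2 V" "h \<in> ell2 V" "h' \<in> ell2 V"
  shows "ell2_inner V f (h + h') = ell2_inner V f h + ell2_inner V f h'"
  unfolding ell2_inner_def
  by (subst infsum_add[symmetric]) (use assms ell2_cmult_summable in \<open>auto simp: algebra_simps\<close>)

lemma ell2_inner_scale_right: "ell2_inner V f (cscale c h) = c * ell2_inner V f h"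
  unfolding ell2_inner_def by (subst infsum_cmult_right'[symmetric]) (simp add: algebra_simps)

lemma ell2_inner_add_left:
  assumes "f \<in> ell2 V" "f' \<in> ell2 V" "h \<in> ell2 V"
  shows "ell2_inner V (f + f') h = ell2_inner V f h + ell2_inner V f' h"
  using ell2_inner_add_right[of h V f f'] assms by (metis complex_cnj_add ell2_inner_commute)

lemma ell2_inner_scale_left: "ell2_inner V (cscale c f) h = cnj c * ell2_inner V f h"
  by (metis complex_cnj_mult ell2_inner_commute ell2_inner_scale_right)

lemma ell2_inner_minus_right: "ell2_inner V f (- h) = - ell2_inner V f h"
  using ell2_inner_scale_right[of V f "-1" h] by (simp add: cscale_def fun_Compl_def)

lemma ell2_inner_diff_right:
  assumes "f \<in> ell2 V" "h \<in> ell2 V" "h' \<in> ell2 V"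
  shows "ell2_inner V f (h - h') = ell2_inner V f h - ell2_inner V f h'"
  using ell2_inner_add_right[OF assms(1), of "h - h'" h'] assms by (simp add: ell2_diff)

lemma ell2_inner_diff_left:
  assumes "f \<in> ell2 V" "f' \<in> ell2 V" "h \<in> ell2 V"
  shows "ell2_inner V (f - f') h = ell2_inner V f h - ell2_inner V f' h"
  using ell2_inner_add_left[of "f - f'" V f' h] assms by (simp add: ell2_diff)

lemma ell2_inner_zero [simp]: "ell2_inner V 0 f = 0" "ell2_inner V f 0 = 0"
  by (simp_all add: ell2_inner_def)

lemma ell2_inner_sum_right:
  assumes "f \<in> ell2 V" "\<And>i. i \<in> I \<Longrightarrow> h i \<in> ell2 V"
  shows "ell2_inner V f (\<Sum>i\<in>I. h i) = (\<Sum>i\<in>I. ell2_inner V f (h i))"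
  using assms(2)
proof (induction I rule: infinite_finite_induct)
  case (insert i I)
  then have "ell2_inner V f (h i + (\<Sum>i\<in>I. h i)) = ell2_inner V f (h i) + ell2_inner V f (\<Sum>i\<in>I. h i)"
    using assms(1) cfun.subspace_sum[OF subspace_ell2, of I h V] by (intro ell2_inner_add_right)
        auto
  with insert show ?case by (metis insertCI sum.insert)
qed (simp_all add: zero_fun_def[symmetric])

lemma ell2_inner_sum_left:
  assumes "h \<in> ell2 V" "\<And>i. i \<in> I \<Longrightarrow> f i \<in> ell2 V"
  shows "ell2_inner V (\<Sum>i\<in>I. f i) h = (\<Sum>i\<in>I. ell2_inner V (f i) h)"
proof -
  have "ell2_inner V (\<Sum>i\<in>I. f i) h = cnj (ell2_inner V h (\<Sum>i\<in>I. f i))"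
    by (rule ell2_inner_commute)
  also have "\<dots> = (\<Sum>i\<in>I. cnj (ell2_inner V h (f i)))"
    using ell2_inner_sum_right[where I = I and h = f, OF assms] by simp
  also have "\<dots> = (\<Sum>i\<in>I. ell2_inner V (f i) h)"
    by (intro sum.cong refl ell2_inner_commute[symmetric])
  finally show ?thesis .
qed

definition ell2_sqnorm :: "'v set \<Rightarrow> ('v \<Rightarrow> complex) \<Rightarrow> real" where
  "ell2_sqnorm V f = (\<Sum>\<^sub>\<infinity>v\<in>V. (cmod (f v))\<^sup>2)"

lemma ell2_inner_self:
  assumes "f \<in> ell2 V"
  shows "ell2_inner V f f = complex_of_real (ell2_sqnorm V f)"
proof -
  have "complex_of_real (ell2_sqnorm V f) = (\<Sum>\<^sub>\<infinity>v\<in>V. complex_of_real ((cmod (f v))\<^sup>2))"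
    unfolding ell2_sqnorm_def by (rule infsumI[symmetric], subst has_sum_of_real_iff) (use assms
        in \<open>simp add: ell2_def\<close>)
  also have "\<dots> = ell2_inner V f f"
    unfolding ell2_inner_def by (simp only: complex_norm_square mult.commute)
  finally show ?thesis by simp
qed

lemma ell2_sqnorm_nonneg: "0 \<le> ell2_sqnorm V f"
  unfolding ell2_sqnorm_def by (rule infsum_nonneg) simp

lemma sum_le_ell2_sqnorm:
  assumes "f \<in> ell2 V" "finite F" "F \<subseteq> V"
  shows "(\<Sum>v\<in>F. (cmod (f v))\<^sup>2) \<le> ell2_sqnorm V f"
  unfolding ell2_sqnorm_def by (rule finite_sum_le_infsum) (use assms in \<open>auto simp: ell2_def\<close>)

lemma ell2_sqnorm_eq_0:
  assumes "f \<in> ell2 V" "ell2_sqnorm V f \<le> 0"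
  shows "f = 0"
proof
  fix v show "f v = 0 v"
  proof (cases "v \<in> V")
    case True
    have "(cmod (f v))\<^sup>2 \<le> 0"
      using order_trans[OF sum_le_ell2_sqnorm[OF assms(1), of "{v}"] assms(2)] True by simp
    then show ?thesis by simp
  qed (use assms in \<open>auto simp: ell2_def\<close>)
qed

lemma ell2_sqnorm_scale: "ell2_sqnorm V (cscale c f) = (cmod c)\<^sup>2 * ell2_sqnorm V f"
  unfolding ell2_sqnorm_def
  by (subst infsum_cmult_right'[symmetric]) (simp add: norm_mult power_mult_distrib)

lemma ell2_sqnorm_diff:
  assumes "f \<in> ell2 V" "h \<in> ell2 V"
  shows "ell2_sqnorm V (f - h) = ell2_sqnorm V f - 2 * Re (ell2_inner V h f) + ell2_sqnorm V h"
proof -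
  have "complex_of_real (ell2_sqnorm V (f - h)) = ell2_inner V (f - h) (f - h)"
    using assms by (simp add: ell2_inner_self ell2_diff)
  also have "\<dots> = ell2_inner V f f - ell2_inner V h f - cnj (ell2_inner V h f) + ell2_inner V h h"
    using assms
    by (simp add: ell2_inner_diff_left ell2_inner_diff_right ell2_diff ell2_inner_commute[of V f h])
  finally have "Re (complex_of_real (ell2_sqnorm V (f - h))) =
      Re (ell2_inner V f f - ell2_inner V h f - cnj (ell2_inner V h f) + ell2_inner V h h)"
    by simp
  then show ?thesis using assms by (simp add: ell2_inner_self)
qed

lemma ell2_inner_self_finite:
  "finite A \<Longrightarrow> ell2_inner A f h = (\<Sum>x\<in>A. cnj (f x) * h x)"
  by (simp add: ell2_inner_def)

lemma orthonormal_basis: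
  assumes "cfun.subspace U" "U \<subseteq> fun_on A" "finite A"
  obtains e where "\<And>i. i < cfun.dim U \<Longrightarrow> e i \<in> U"
    and "\<And>i j. i < cfun.dim U \<Longrightarrow> j < cfun.dim U \<Longrightarrow>
           ell2_inner A (e i) (e j) = (if i = j then 1 else 0)"
    and "\<And>f. f \<in> U \<Longrightarrow> f = (\<Sum>i<cfun.dim U. cscale (ell2_inner A (e i) f) (e i))"
proof -
  have "\<exists>e. (\<forall>i<n. e i \<in> U) \<and>
      (\<forall>i<n. \<forall>j<n. ell2_inner A (e i) (e j) = (if i = j then 1 else 0)) \<and>
      (\<forall>f\<in>U. f = (\<Sum>i<n. cscale (ell2_inner A (e i) f) (e i)))"
    if "n = cfun.dim U" for n
    using assms(1,2) that
  proof (induction n arbitrary: U)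
    case 0
    obtain B where B: "B \<subseteq> U" "cfun.independent B" "U \<subseteq> cfun.span B" "card B = cfun.dim U"
      by (rule cfun.basis_exists)
    have "finite B"
      using cfun.independent_span_bound[of "point_mass ` A" B] B(1,2) 0(2) fun_on_subset_span[OF
          assms(3)]
        assms(3) by blast
    then have "B = {}" using B(4) 0(3) by simp
    then have "U \<subseteq> {0}" using B(3) by simp
    then show ?case by (auto simp: fun_eq_iff)
  next
    case (Suc n)
    note sub = Suc.prems(1) and UA = Suc.prems(2)
    have UE: "f \<in> ell2 A" if "f \<in> U" for f
      using that UA fun_on_ell2[OF assms(3), of A] by blast
    have "\<not> U \<subseteq> fun_on {}"
    proof
      assume "U \<subseteq> fun_on {}"
      then have "cfun.dim U \<le> card ({} :: 'a set)" by (rule dim_le_card) simp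
      then show False using Suc.prems(3) by simp
    qed
    then obtain u where u: "u \<in> U" "u \<noteq> 0" by (auto simp: fun_on_def fun_eq_iff)
    define s where "s = ell2_sqnorm A u"
    have "s > 0" using ell2_sqnorm_eq_0[OF UE[OF u(1)]] u(2) unfolding s_def by force
    define e0 where "e0 = cscale (complex_of_real (1 / sqrt s)) u"
    have e0U: "e0 \<in> U" unfolding e0_def by (rule cfun.subspace_scale[OF sub u(1)])
    have "ell2_sqnorm A e0 = 1"
      using \<open>s > 0\<close> unfolding e0_def ell2_sqnorm_scale s_def[symmetric]
      by (simp add: norm_divide power_divide del: of_real_divide)
    then have e00: "ell2_inner A e0 e0 = 1" using ell2_inner_self[OF UE[OF e0U]] by simp
    define T where "T f = (\<lambda>_::unit. ell2_inner A e0 f)" for f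
    define U' where "U' = {f \<in> U. T f = 0}"
    have Tadd: "T (f + h) = T f + T h" if "f \<in> U" "h \<in> U" for f h
      using that UE e0U by (simp add: T_def fun_eq_iff ell2_inner_add_right del: plus_fun_apply)
          simp
    have Tscale: "T (cscale c f) = cscale c (T f)" for c f
      by (rule ext) (simp only: T_def ell2_inner_scale_right cscale_apply)
    have T0: "T 0 = 0" by (auto simp: T_def fun_eq_iff)
    have "cfun.dim (T ` U) + cfun.dim U' = cfun.dim U"
      unfolding U'_def by (rule rank_nullity[OF sub UA assms(3)]) (use Tadd Tscale in auto)
    moreover have "T ` U = fun_on {()}"
    proof -
      have "f \<in> T ` U" for f
      proof
        show "f = T (cscale (f ()) e0)"
          unfolding Tscale by (simp add: T_def e00 fun_eq_iff)
        show "cscale (f ()) e0 \<in> U" by (rule cfun.subspace_scale[OF sub e0U])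
      qed
      then show ?thesis by (auto simp: fun_on_def)
    qed
    ultimately have dimU': "n = cfun.dim U'"
      using Suc.prems(3) dim_fun_on[of "{()}"] by (simp del: cscale_apply)
    have subU': "cfun.subspace U'"
    proof (rule cfun.subspaceI)
      show "0 \<in> U'" unfolding U'_def using cfun.subspace_0[OF sub] T0 by simp
      show "x + y \<in> U'" if "x \<in> U'" "y \<in> U'" for x y
        using that cfun.subspace_add[OF sub, of x y] Tadd[of x y]
        by (simp add: U'_def del: plus_fun_apply)
      show "cscale c x \<in> U'" if "x \<in> U'" for c x
        using that cfun.subspace_scale[OF sub, of x c] Tscale[of c x]
        by (simp add: U'_def del: cscale_apply)
    qed
    then obtain e where e: "\<forall>i<n. e i \<in> U'"
      "\<forall>i<n. \<forall>j<n. ell2_inner A (e i) (e j) = (if i = j then 1 else 0)"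
      "\<forall>f\<in>U'. f = (\<Sum>i<n. cscale (ell2_inner A (e i) f) (e i))"
      using Suc.IH[of U'] dimU' UA U'_def by blast
    define e' where "e' i = (if i < n then e i else e0)" for i
    have eU: "e i \<in> U" "ell2_inner A e0 (e i) = 0" "ell2_inner A (e i) e0 = 0" if "i < n" for i
      using e(1) that ell2_inner_commute[of A "e i" e0] by (auto simp: U'_def T_def fun_eq_iff)
    have "f = (\<Sum>i<Suc n. cscale (ell2_inner A (e' i) f) (e' i))" if f: "f \<in> U" for f
    proof -
      define f' where "f' = f - cscale (ell2_inner A e0 f) e0"
      have sc: "cscale (ell2_inner A e0 f) e0 \<in> U" by (rule cfun.subspace_scale[OF sub e0U])
      have ip: "ell2_inner A x f' = ell2_inner A x f - ell2_inner A e0 f * ell2_inner A x e0" if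
          "x \<in> U" for x
        unfolding f'_def ell2_inner_scale_right[symmetric]
        by (rule ell2_inner_diff_right) (use UE that f sc in auto)
      have "f' \<in> U'"
        using cfun.subspace_diff[OF sub f sc] ip[OF e0U] e00
        by (auto simp: U'_def f'_def[symmetric] T_def fun_eq_iff)
      then have "f' = (\<Sum>i<n. cscale (ell2_inner A (e i) f') (e i))" using e(3) by blast
      also have "\<dots> = (\<Sum>i<n. cscale (ell2_inner A (e' i) f) (e' i))"
        using ip[OF eU(1)] eU by (intro sum.cong) (auto simp: e'_def)
      finally have "f' + cscale (ell2_inner A e0 f) e0
          = (\<Sum>i<n. cscale (ell2_inner A (e' i) f) (e' i)) + cscale (ell2_inner A (e' n) f) (e' n)"
        by (simp add: e'_def del: plus_fun_apply cscale_apply)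
      moreover have "f' + cscale (ell2_inner A e0 f) e0 = f" by (simp add: f'_def fun_eq_iff)
      ultimately show ?thesis by (simp only: sum.lessThan_Suc)
    qed
    moreover have "\<forall>i<Suc n. e' i \<in> U" using eU e0U by (auto simp: e'_def)
    moreover have "\<forall>i<Suc n. \<forall>j<Suc n. ell2_inner A (e' i) (e' j) = (if i = j then 1 else 0)"
      using eU e(2) e00 by (auto simp: e'_def less_Suc_eq)
    ultimately show ?case by blast
  qed
  from this[OF refl] that show ?thesis by blast
qed

lemma ell2_sqnorm_add:
  assumes "f \<in> ell2 V" "h \<in> ell2 V"
  shows "ell2_sqnorm V (f + h) + ell2_sqnorm V (f - h) = 2 * ell2_sqnorm V f + 2 * ell2_sqnorm V h"
proof -
  define h' where "h' = cscale (-1) h"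
  have h': "h' \<in> ell2 V" "f + h = f - h'"
    using ell2_scale[OF assms(2), of "-1"] by (auto simp: h'_def fun_eq_iff)
  have "ell2_inner V h' f = - ell2_inner V h f" "ell2_sqnorm V h' = ell2_sqnorm V h"
    unfolding h'_def by (simp_all only: ell2_inner_scale_left ell2_sqnorm_scale) simp_all
  then show ?thesis
    unfolding h'(2) using ell2_sqnorm_diff[OF assms] ell2_sqnorm_diff[OF assms(1) h'(1)] by simp
qed

lemma projection_exists:
  assumes sub: "cfun.subspace H" and HV: "H \<subseteq> ell2 V"
    and closed: "\<And>F f. (\<And>n::nat. F n \<in> H) \<Longrightarrow> f \<in> ell2 V \<Longrightarrow> (\<And>v. (\<lambda>n. F n v) \<longlonglongrightarrow> f v) \<Longrightarrow> f \<in> H"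
    and q: "q \<in> ell2 V"
  obtains p where "p \<in> H" "\<And>h. h \<in> H \<Longrightarrow> ell2_inner V h (q - p) = 0"
proof -
  define J where "J h = ell2_sqnorm V (q - h)" for h
  define m where "m = Inf (J ` H)"
  have bdd: "bdd_below (J ` H)" using ell2_sqnorm_nonneg by (intro bdd_belowI[of _ 0]) (auto
      simp: J_def)
  have m_le: "m \<le> J h" if "h \<in> H" for h unfolding m_def by (rule cInf_lower) (use bdd that in auto)
  have "H \<noteq> {}" using cfun.subspace_0[OF sub] by auto
  have "\<exists>h\<in>H. J h < m + 1 / (real n + 1)" for n
    using cInf_lessD[of "J ` H" "m + 1 / (real n + 1)"] \<open>H \<noteq> {}\<close> by (auto simp: m_def[symmetric])
  then obtain F where F: "\<And>n. F n \<in> H" "\<And>n. J (F n) < m + 1 / (real n + 1)" by metis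
  have FV: "F n \<in> ell2 V" for n using F(1) HV by blast
  have diff: "ell2_sqnorm V (F i - F j) \<le> 2 / (real i + 1) + 2 / (real j + 1)" for i j
  proof -
    define c where "c = cscale (1/2) (F i + F j)"
    have "c \<in> H" unfolding c_def by (intro cfun.subspace_scale cfun.subspace_add sub F)
    have 1: "(q - F i) + (q - F j) = cscale 2 (q - c)" by (simp add: c_def fun_eq_iff algebra_simps)
    have 2: "(q - F j) - (q - F i) = F i - F j" by (simp add: fun_eq_iff)
    have "(q - F j) + (q - F i) = (q - F i) + (q - F j)" by (rule add.commute)
    then have "ell2_sqnorm V (cscale 2 (q - c)) + ell2_sqnorm V (F i - F j) = 2 * J (F i) + 2 * J
        (F j)"
      using ell2_sqnorm_add[of "q - F j" V "q - F i"] ell2_diff[OF q FV] 1 2 by (simp add: J_def)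
    then have "4 * J c + ell2_sqnorm V (F i - F j) = 2 * J (F i) + 2 * J (F j)"
      by (simp only: ell2_sqnorm_scale J_def) simp
    then show ?thesis using m_le[OF \<open>c \<in> H\<close>] F(2)[of i] F(2)[of j] by simp
  qed
  have "convergent (\<lambda>n. F n v)" for v
  proof (cases "v \<in> V")
    case True
    have "Cauchy (\<lambda>n. F n v)"
    proof (rule metric_CauchyI)
      fix e :: real assume "e > 0"
      then obtain N where N: "4 / (real N + 1) < e\<^sup>2"
        using reals_Archimedean[of "e\<^sup>2 / 4"] by (auto simp: field_simps)
      have "dist (F i v) (F j v) < e" if "i \<ge> N" "j \<ge> N" for i j
      proof -
        have "(cmod ((F i - F j) v))\<^sup>2 \<le> ell2_sqnorm V (F i - F j)"
          using sum_le_ell2_sqnorm[OF ell2_diff[OF FV FV], of "{v}" i j] True by simp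
        also have "\<dots> \<le> 2 / (real i + 1) + 2 / (real j + 1)" by (rule diff)
        also have "\<dots> \<le> 2 / (real N + 1) + 2 / (real N + 1)"
          by (intro add_mono divide_left_mono) (use that in auto)
        also have "\<dots> < e\<^sup>2" using N by simp
        finally show ?thesis using \<open>e > 0\<close> power2_less_imp_less by (fastforce simp: dist_norm)
      qed
      then show "\<exists>M. \<forall>i\<ge>M. \<forall>j\<ge>M. dist (F i v) (F j v) < e" by blast
    qed
    then show ?thesis by (simp add: Cauchy_convergent_iff)
  next
    case False
    then show ?thesis using ell2_outside[OF FV] by (simp add: convergent_const)
  qed
  then obtain p where p: "\<And>v. (\<lambda>n. F n v) \<longlonglongrightarrow> p v" unfolding convergent_def by metis
  have fin: "(\<Sum>v\<in>A. (cmod (q v - p v))\<^sup>2) \<le> m" if "finite A" "A \<subseteq> V" for A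
  proof (rule LIMSEQ_le)
    show "(\<lambda>n. \<Sum>v\<in>A. (cmod (q v - F n v))\<^sup>2) \<longlonglongrightarrow> (\<Sum>v\<in>A. (cmod (q v - p v))\<^sup>2)"
      by (intro tendsto_intros p)
    have "(\<lambda>n. m + 1 / real (Suc n)) \<longlonglongrightarrow> m + 0"
      using LIMSEQ_inverse_real_of_nat by (intro tendsto_intros) (simp add: inverse_eq_divide)
    then show "(\<lambda>n. m + 1 / (real n + 1)) \<longlonglongrightarrow> m" by (simp add: add.commute)
    have "(\<Sum>v\<in>A. (cmod (q v - F n v))\<^sup>2) \<le> m + 1 / (real n + 1)" for n
      using sum_le_ell2_sqnorm[OF ell2_diff[OF q FV] that, of n] F(2)[of n] by (simp add: J_def)
    then show "\<exists>N. \<forall>n\<ge>N. (\<Sum>v\<in>A. (cmod (q v - F n v))\<^sup>2) \<le> m + 1 / (real n + 1)" by blast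
  qed
  have sm: "(\<lambda>v. (cmod (q v - p v))\<^sup>2) summable_on V"
    by (rule nonneg_bdd_above_summable_on) (use fin in \<open>auto intro!: bdd_aboveI[of _ m]\<close>)
  have p0: "p v = 0" if "v \<notin> V" for v
    using LIMSEQ_unique[OF p[of v]] ell2_outside[OF FV that] by simp
  have qp: "q - p \<in> ell2 V" using sm p0 ell2_outside[OF q] by (simp add: ell2_def)
  have "p = q - (q - p)" by simp
  then have "p \<in> ell2 V" using ell2_diff[OF q qp] by simp
  then have pH: "p \<in> H" using closed[of F p] F(1) p by blast
  have Jp: "J p \<le> m"
    unfolding J_def ell2_sqnorm_def by (rule infsum_le_finite_sums) (use sm fin in auto)
  have "ell2_inner V h (q - p) = 0" if h: "h \<in> H" for h
  proof (rule ccontr)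
    define c where "c = ell2_inner V h (q - p)"
    define N where "N = ell2_sqnorm V h"
    assume "ell2_inner V h (q - p) \<noteq> 0"
    then have "c \<noteq> 0" by (simp add: c_def)
    then have "h \<noteq> 0" by (auto simp: c_def)
    then have "N > 0" using ell2_sqnorm_eq_0[of h V] h HV by (force simp: N_def)
    define t where "t = c / N"
    have th: "cscale t h \<in> H" by (rule cfun.subspace_scale[OF sub h])
    have "p + cscale t h \<in> H" by (rule cfun.subspace_add[OF sub pH th])
    then have "m \<le> J (p + cscale t h)" by (rule m_le)
    also have "\<dots> = ell2_sqnorm V ((q - p) - cscale t h)" by (simp only: J_def diff_diff_eq)
    also have "\<dots> = J p - 2 * Re (cnj t * c) + (cmod t)\<^sup>2 * N"
      using ell2_sqnorm_diff[OF qp, of "cscale t h"] th HV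
      by (simp add: J_def c_def N_def ell2_inner_scale_left ell2_sqnorm_scale subset_iff del:
          cscale_apply)
    also have "cnj t * c = complex_of_real ((cmod c)\<^sup>2 / N)"
      by (simp add: t_def complex_norm_square[symmetric] mult.commute)
    also have "(cmod t)\<^sup>2 * N = (cmod c)\<^sup>2 / N"
      using \<open>N > 0\<close> by (simp add: t_def norm_divide power2_eq_square)
    finally have "m \<le> J p - (cmod c)\<^sup>2 / N" by simp
    moreover have "(cmod c)\<^sup>2 / N > 0" using \<open>c \<noteq> 0\<close> \<open>N > 0\<close> by simp
    ultimately show False using Jp by simp
  qed
  with pH that show ?thesis by blast
qed

section \<open>The diagonal of a reproducing kernel\<close>

locale reproducing_kernel =
  fixes V :: "'v set" and H :: "('v \<Rightarrow> complex) set" and p :: "'v \<Rightarrow> 'v \<Rightarrow> complex"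
  assumes subspace_H: "cfun.subspace H" and H_ell2: "H \<subseteq> ell2 V"
    and kernel_in_H: "v \<in> V \<Longrightarrow> p v \<in> H"
    and reproducing: "v \<in> V \<Longrightarrow> h \<in> H \<Longrightarrow> ell2_inner V h (p v) = cnj (h v)"
begin

lemma sqnorm_kernel: "v \<in> V \<Longrightarrow> complex_of_real (ell2_sqnorm V (p v)) = p v v"
  using reproducing[OF _ kernel_in_H, of v v] ell2_inner_self[of "p v" V] kernel_in_H[of v] H_ell2
  by (metis complex_cnj_cnj complex_cnj_complex_of_real subsetD)

lemma dim_le_trace:
  assumes K: "cfun.subspace K" "K \<subseteq> H" "K \<subseteq> fun_on Q" and Q: "finite Q" "Q \<subseteq> V"
  shows "real (cfun.dim K) \<le> (\<Sum>v\<in>Q. Re (p v v))"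
proof -
  obtain e where e: "\<And>i. i < cfun.dim K \<Longrightarrow> e i \<in> K"
    "\<And>i j. i < cfun.dim K \<Longrightarrow> j < cfun.dim K \<Longrightarrow> ell2_inner Q (e i) (e j) = (if i = j then 1 else 0)"
    by (rule orthonormal_basis[OF K(1,3) Q(1)]) blast
  have KV: "f \<in> ell2 V" if "f \<in> K" for f using that K H_ell2 by blast
  have ip: "ell2_inner V (e i) (e j) = (if i = j then 1 else 0)" if "i < cfun.dim K" "j <
      cfun.dim K" for i j
    using ell2_inner_fun_on[OF subsetD[OF K(3) e(1)] Q(2), of i "e j"] e(2) that by simp
  have bessel: "(\<Sum>i<cfun.dim K. (cmod (e i v))\<^sup>2) \<le> Re (p v v)" if v: "v \<in> Q" for v
  proof -
    let ?n = "cfun.dim K"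
    define s where "s = (\<Sum>i<?n. cscale (cnj (e i v)) (e i))"
    define t where "t = (\<Sum>i<?n. (cmod (e i v))\<^sup>2)"
    have sc: "cscale (cnj (e i v)) (e i) \<in> K" if "i < ?n" for i
      by (rule cfun.subspace_scale[OF K(1) e(1)[OF that]])
    have sK: "s \<in> K" unfolding s_def by (rule cfun.subspace_sum[OF K(1)]) (use sc in auto)
    have sv: "s x = (\<Sum>i<?n. cnj (e i v) * e i x)" for x
      unfolding s_def by (rule sum_cscale_apply)
    have "s v = complex_of_real t"
      unfolding sv t_def of_real_sum complex_norm_square by (simp add: mult.commute)
    moreover have "complex_of_real (ell2_sqnorm V s) = complex_of_real t"
    proof -
      have "ell2_inner V s (e j) = e j v" if "j < ?n" for j
      proof -
        have "ell2_inner V s (e j) = (\<Sum>i<?n. ell2_inner V (cscale (cnj (e i v)) (e i)) (e j))"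
          unfolding s_def by (rule ell2_inner_sum_left) (use sc KV e(1) that in auto)
        also have "\<dots> = (\<Sum>i<?n. e i v * (if i = j then 1 else 0))"
          using ip that by (simp add: ell2_inner_scale_left del: cscale_apply)
        also have "\<dots> = e j v" using that by (simp add: if_distrib sum.delta cong: if_cong)
        finally show ?thesis .
      qed
      moreover have "ell2_inner V s s = (\<Sum>j<?n. ell2_inner V s (cscale (cnj (e j v)) (e j)))"
        unfolding s_def by (rule ell2_inner_sum_right) (use sc KV sK in \<open>auto simp:
            s_def[symmetric]\<close>)
      ultimately have "ell2_inner V s s = (\<Sum>j<?n. cnj (e j v) * e j v)"
        by (simp add: ell2_inner_scale_right del: cscale_apply)
      also have "\<dots> = complex_of_real t"
        unfolding t_def of_real_sum complex_norm_square by (simp add: mult.commute)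
      finally show ?thesis using ell2_inner_self[OF KV[OF sK]] by simp
    qed
    moreover have "Re (complex_of_real (ell2_sqnorm V (p v))) = Re (p v v)"
      using arg_cong[OF sqnorm_kernel[of v], of Re] v Q by auto
    moreover have "ell2_inner V s (p v) = cnj (s v)" by (rule reproducing) (use v Q sK K in auto)
    ultimately have "ell2_sqnorm V s = t" "Re (ell2_inner V s (p v)) = t"
      "ell2_sqnorm V (p v) = Re (p v v)"
      by (metis of_real_eq_iff, metis complex_cnj_complex_of_real Re_complex_of_real,
          metis Re_complex_of_real)
    then show ?thesis
      using ell2_sqnorm_diff[OF subsetD[OF H_ell2 kernel_in_H[OF subsetD[OF Q(2) v]]] KV[OF sK]]
        ell2_sqnorm_nonneg[of V "p v - s"] by (simp add: t_def[symmetric])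
  qed
  have "complex_of_real (\<Sum>v\<in>Q. (cmod (e i v))\<^sup>2) = 1" if "i < cfun.dim K" for i
    using e(2)[OF that that] Q(1) unfolding of_real_sum complex_norm_square
    by (simp add: ell2_inner_def mult.commute)
  then have one: "(\<Sum>v\<in>Q. (cmod (e i v))\<^sup>2) = 1" if "i < cfun.dim K" for i
    using that by (metis of_real_eq_1_iff)
  have "real (cfun.dim K) = (\<Sum>i<cfun.dim K. \<Sum>v\<in>Q. (cmod (e i v))\<^sup>2)" using one by simp
  also have "\<dots> = (\<Sum>v\<in>Q. \<Sum>i<cfun.dim K. (cmod (e i v))\<^sup>2)" by (rule sum.swap)
  also have "\<dots> \<le> (\<Sum>v\<in>Q. Re (p v v))" by (intro sum_mono bessel)
  finally show ?thesis .
qed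

lemma trace_le_dim:
  assumes Q: "finite Q" "Q \<subseteq> V"
  shows "(\<Sum>v\<in>Q. Re (p v v)) \<le> real (cfun.dim (restrict_support Q ` H))"
proof -
  define U where "U = restrict_support Q ` H"
  define n where "n = cfun.dim U"
  have UQ: "U \<subseteq> fun_on Q" using restrict_support_fun_on by (auto simp: U_def)
  have subU: "cfun.subspace U"
    unfolding U_def by (rule subspace_restrict[OF subspace_H])
  obtain e where e: "\<And>i. i < n \<Longrightarrow> e i \<in> U"
    "\<And>i j. i < n \<Longrightarrow> j < n \<Longrightarrow> ell2_inner Q (e i) (e j) = (if i = j then 1 else 0)"
    "\<And>f. f \<in> U \<Longrightarrow> f = (\<Sum>i<n. cscale (ell2_inner Q (e i) f) (e i))"
    by (rule orthonormal_basis[OF subU UQ Q(1), folded n_def]) blast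
  have eV: "e i \<in> ell2 V" if "i < n" for i using e(1)[OF that] UQ fun_on_ell2[OF Q] by blast
  define q where "q i = (\<Sum>v\<in>Q. cscale (e i v) (p v))" for i
  have sc: "cscale c (p v) \<in> H" if "v \<in> Q" for v c
    by (rule cfun.subspace_scale[OF subspace_H kernel_in_H]) (use that Q in auto)
  have qH: "q i \<in> H" for i unfolding q_def by (rule cfun.subspace_sum[OF subspace_H sc])
  have qy: "q i y = (\<Sum>v\<in>Q. e i v * p v y)" for i y
    unfolding q_def by (rule sum_cscale_apply)
  have hq: "ell2_inner V h (q i) = ell2_inner V h (e i)" if h: "h \<in> H" and i: "i < n" for h i
  proof -
    have "ell2_inner V h (q i) = (\<Sum>v\<in>Q. ell2_inner V h (cscale (e i v) (p v)))"
      unfolding q_def by (rule ell2_inner_sum_right) (use h H_ell2 sc in auto)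
    also have "\<dots> = (\<Sum>v\<in>Q. e i v * cnj (h v))"
      by (rule sum.cong) (use reproducing h Q in \<open>auto simp: ell2_inner_scale_right simp del:
          cscale_apply\<close>)
    also have "\<dots> = cnj (ell2_inner Q (e i) h)" using Q(1) by (simp add: ell2_inner_def)
    also have "\<dots> = cnj (ell2_inner V (e i) h)"
      using ell2_inner_fun_on[of "e i" Q V h] e(1)[OF i] UQ Q by auto
    finally show ?thesis by (simp only: ell2_inner_commute[of V h "e i"])
  qed
  have qle: "Re (ell2_inner V (e i) (q i)) \<le> 1" if i: "i < n" for i
  proof -
    have "ell2_inner V (q i) (e i) = complex_of_real (ell2_sqnorm V (q i))"
      using hq[OF qH i, of i] ell2_inner_self[OF subsetD[OF H_ell2 qH], of i] by simp
    then have q: "Re (ell2_inner V (q i) (e i)) = ell2_sqnorm V (q i)"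
      by (simp only: Re_complex_of_real)
    have "complex_of_real (ell2_sqnorm V (e i)) = 1"
      using ell2_inner_self[OF eV[OF i]] e(2)[OF i i]
        ell2_inner_fun_on[OF subsetD[OF UQ e(1)[OF i]] Q(2), of "e i"] by simp
    then have e: "ell2_sqnorm V (e i) = 1" by (simp only: of_real_eq_1_iff)
    have "Re (ell2_inner V (e i) (q i)) = Re (ell2_inner V (q i) (e i))"
      unfolding ell2_inner_commute[of V "e i" "q i"] by simp
    then show ?thesis
      using ell2_sqnorm_diff[OF eV[OF i] subsetD[OF H_ell2 qH], of i]
        ell2_sqnorm_nonneg[of V "e i - q i"] q e by linarith
  qed
  have diag: "p v v = (\<Sum>i<n. (\<Sum>y\<in>Q. cnj (e i y) * p v y) * e i v)" if v: "v \<in> Q" for v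
  proof -
    have "restrict_support Q (p v) \<in> U" using kernel_in_H v Q by (auto simp: U_def)
    then have "restrict_support Q (p v) = (\<Sum>i<n. cscale (ell2_inner Q (e i) (restrict_support Q
        (p v))) (e i))"
      by (rule e(3))
    then have "restrict_support Q (p v) v = (\<Sum>i<n. cscale (ell2_inner Q (e i) (restrict_support Q
        (p v))) (e i)) v"
      by (rule fun_cong)
    also have "\<dots> = (\<Sum>i<n. ell2_inner Q (e i) (restrict_support Q (p v)) * e i v)"
      by (rule sum_cscale_apply)
    finally show ?thesis using v Q(1) by (simp add: restrict_support_def ell2_inner_self_finite)
  qed
  have "(\<Sum>v\<in>Q. p v v) = (\<Sum>v\<in>Q. \<Sum>i<n. (\<Sum>y\<in>Q. cnj (e i y) * p v y) * e i v)"
    by (rule sum.cong) (use diag in auto)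
  also have "\<dots> = (\<Sum>i<n. \<Sum>v\<in>Q. \<Sum>y\<in>Q. cnj (e i y) * (e i v * p v y))"
    by (subst sum.swap) (simp only: sum_distrib_right mult.assoc mult.commute[of "p _ _"])
  also have "\<dots> = (\<Sum>i<n. \<Sum>y\<in>Q. cnj (e i y) * q i y)"
    unfolding qy sum_distrib_left by (intro sum.cong refl sum.swap)
  also have "\<dots> = (\<Sum>i<n. ell2_inner V (e i) (q i))"
  proof (rule sum.cong[OF refl])
    fix i assume "i \<in> {..<n}"
    then have i: "e i \<in> fun_on Q" by (intro subsetD[OF UQ] e(1)) simp
    show "(\<Sum>y\<in>Q. cnj (e i y) * q i y) = ell2_inner V (e i) (q i)"
      unfolding ell2_inner_fun_on[OF i Q(2)] by (rule ell2_inner_self_finite[OF Q(1), symmetric])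
  qed
  finally have "Re (\<Sum>v\<in>Q. p v v) = Re (\<Sum>i<n. ell2_inner V (e i) (q i))"
    by (rule arg_cong)
  then have "(\<Sum>v\<in>Q. Re (p v v)) = (\<Sum>i<n. Re (ell2_inner V (e i) (q i)))"
    by (simp only: Re_sum)
  also have "\<dots> \<le> (\<Sum>i<n. 1)" by (rule sum_mono) (use qle in auto)
  finally show ?thesis unfolding n_def U_def by simp
qed

end

section \<open>Balls in groups of subexponential growth\<close>

locale subexponential_balls = group G for G :: "('g, 'm) monoid_scheme" (structure) +
  fixes B :: "nat \<Rightarrow> 'g set"
  assumes B_carrier: "B n \<subseteq> carrier G"
    and B_finite: "finite (B n)"
    and B_one: "\<one> \<in> B 0"
    and B_mono: "m \<le> n \<Longrightarrow> B m \<subseteq> B n"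
    and B_mult: "g \<in> B m \<Longrightarrow> h \<in> B n \<Longrightarrow> g \<otimes> h \<in> B (m + n)"
    and B_inv: "g \<in> B n \<Longrightarrow> inv g \<in> B n"
    and B_exhaust: "g \<in> carrier G \<Longrightarrow> \<exists>n. g \<in> B n"
    and B_slow: "e > 0 \<Longrightarrow> \<exists>n. real (card (B (n + m))) \<le> (1 + e) * real (card (B n))"

lemma slow_growth:
  fixes b :: "nat \<Rightarrow> nat" and e :: real
  assumes "b 0 > 0" and "\<And>c. c > 1 \<Longrightarrow> (\<lambda>n. real (b n)) \<in> o(\<lambda>n. c ^ n)" and "e > 0"
  shows "\<exists>n. real (b (n + m)) \<le> (1 + e) * real (b n)"
proof (rule ccontr)
  assume "\<not> ?thesis"
  then have step: "real (b (n + m)) > (1 + e) * real (b n)" for n by (simp add: not_le)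
  have "m \<noteq> 0"
  proof
    assume "m = 0"
    then have "e * real (b 0) < 0" using step[of 0] by (simp add: algebra_simps)
    then show False using assms(1,3) by (simp add: mult_less_0_iff)
  qed
  have low: "(1 + e) ^ j \<le> real (b (j * m))" for j
  proof (induction j)
    case 0
    then show ?case using assms(1) by simp
  next
    case (Suc j)
    have "(1 + e) ^ Suc j \<le> (1 + e) * real (b (j * m))" using Suc assms(3) by simp
    also have "\<dots> \<le> real (b (Suc j * m))" using step[of "j * m"] by (simp add: add.commute)
    finally show ?case .
  qed
  define c where "c = root m (1 + e)"
  have "c > 1" using \<open>m \<noteq> 0\<close> assms(3) by (simp add: c_def)
  have cm: "c ^ m = 1 + e" using \<open>m \<noteq> 0\<close> assms(3) by (simp add: c_def)
  have "\<forall>\<^sub>F n in sequentially. norm (real (b n)) \<le> 1/2 * norm (c ^ n)"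
    by (rule landau_o.smallD[OF assms(2)[OF \<open>c > 1\<close>]]) simp
  then obtain N where N: "\<And>n. n \<ge> N \<Longrightarrow> real (b n) \<le> 1/2 * c ^ n"
    using \<open>c > 1\<close> by (auto simp: eventually_sequentially)
  have "(1 + e) ^ N \<le> 1/2 * c ^ (N * m)"
    using low[of N] N[of "N * m"] \<open>m \<noteq> 0\<close> by (simp add: le_trans)
  also have "c ^ (N * m) = (1 + e) ^ N" by (metis cm mult.commute power_mult)
  finally have "(1 + e) ^ N \<le> 0" by simp
  then show False using assms(3) zero_less_power[of "1 + e" N] by linarith
qed

lemma (in subexponential_balls) eq_of_boundary_estimate:
  fixes s t C :: real
  assumes "\<And>n. \<bar>s - t\<bar> * real (card (B n)) \<le> C * (real (card (B (n + m))) - real (card (B n)))"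
  shows "s = t"
proof -
  have le: "\<bar>s - t\<bar> \<le> \<bar>C\<bar> * e" if e: "e > 0" for e
  proof -
    obtain n where n: "real (card (B (n + m))) \<le> (1 + e) * real (card (B n))"
      using B_slow[OF e, of m] by blast
    have "\<one> \<in> B n" using B_one B_mono[of 0 n] by auto
    then have pos: "real (card (B n)) > 0" using B_finite by (auto simp: card_gt_0_iff)
    have "0 \<le> real (card (B (n + m))) - real (card (B n))"
      using card_mono[OF B_finite B_mono[of n "n + m"]] by simp
    then have "C * (real (card (B (n + m))) - real (card (B n))) \<le> \<bar>C\<bar> * (e * real (card (B n)))"
      using n by (intro mult_mono) (auto simp: algebra_simps)
    then have "\<bar>s - t\<bar> * real (card (B n)) \<le> (\<bar>C\<bar> * e) * real (card (B n))"
      using assms[of n] by (simp add: mult.assoc)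
    then show ?thesis using pos by simp
  qed
  have "\<bar>s - t\<bar> \<le> 0 + e" if e: "e > 0" for e
  proof -
    have "\<bar>s - t\<bar> \<le> \<bar>C\<bar> * (e / (\<bar>C\<bar> + 1))"
      by (rule le) (use e in \<open>simp add: add_nonneg_pos\<close>)
    also have "\<dots> \<le> e" using e by (simp add: field_simps)
    finally show ?thesis by simp
  qed
  then have "\<bar>s - t\<bar> \<le> 0" by (rule field_le_epsilon)
  then show ?thesis by simp
qed

context group begin

lemma foldr_mult_append:
  "set xs \<subseteq> carrier G \<Longrightarrow> set ys \<subseteq> carrier G \<Longrightarrow>
     foldr (\<otimes>) (xs @ ys) \<one> = foldr (\<otimes>) xs \<one> \<otimes> foldr (\<otimes>) ys \<one> \<and> foldr (\<otimes>) xs \<one> \<in> carrier G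
       \<and> foldr (\<otimes>) ys \<one> \<in> carrier G"
proof (induction xs)
  case Nil
  then show ?case by (induction ys) auto
next
  case (Cons x xs)
  then show ?case by (simp add: m_assoc)
qed

lemma foldr_mult_closed: "set xs \<subseteq> carrier G \<Longrightarrow> foldr (\<otimes>) xs \<one> \<in> carrier G"
  using foldr_mult_append[of xs "[]"] by simp

lemma inv_foldr_mult:
  "set xs \<subseteq> carrier G \<Longrightarrow> inv (foldr (\<otimes>) xs \<one>) = foldr (\<otimes>) (rev (map (\<lambda>x. inv x) xs)) \<one>"
proof (induction xs)
  case (Cons x xs)
  have "set (rev (map (\<lambda>x. inv x) xs)) \<subseteq> carrier G" using Cons.prems by auto
  then show ?case using Cons foldr_mult_append[of "rev (map (\<lambda>x. inv x) xs)" "[inv x]"]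
    by (simp add: inv_mult_group foldr_mult_closed)
qed simp

lemma generate_word:
  assumes "S \<subseteq> carrier G" "g \<in> generate G S"
  shows "\<exists>xs. set xs \<subseteq> S \<union> (\<lambda>s. inv s) ` S \<and> g = foldr (\<otimes>) xs \<one>"
  using assms(2)
proof (induction)
  case one
  then show ?case by (intro exI[of _ "[]"]) simp
next
  case (incl h)
  then show ?case using assms(1) by (intro exI[of _ "[h]"]) auto
next
  case (inv h)
  then show ?case using assms(1) by (intro exI[of _ "[inv h]"]) auto
next
  case (eng h1 h2)
  then obtain xs ys where w: "set xs \<subseteq> S \<union> (\<lambda>s. inv s) ` S" "h1 = foldr (\<otimes>) xs \<one>"
    "set ys \<subseteq> S \<union> (\<lambda>s. inv s) ` S" "h2 = foldr (\<otimes>) ys \<one>" by blast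
  have "S \<union> (\<lambda>s. inv s) ` S \<subseteq> carrier G" using assms(1) by auto
  then have "set xs \<subseteq> carrier G" "set ys \<subseteq> carrier G" using w by blast+
  then show ?case using w foldr_mult_append[of xs ys] by (intro exI[of _ "xs @ ys"]) auto
qed

lemma word_length_le_iff:
  assumes "S \<subseteq> carrier G" "generate G S = carrier G" "g \<in> carrier G"
  shows "word_length G S g \<le> n \<longleftrightarrow>
    (\<exists>xs. length xs \<le> n \<and> set xs \<subseteq> S \<union> (\<lambda>s. inv s) ` S \<and> g = foldr (\<otimes>) xs \<one>)"
proof -
  let ?P = "\<lambda>n. \<exists>xs. length xs = n \<and> set xs \<subseteq> S \<union> (\<lambda>s. inv s) ` S \<and> g = foldr (\<otimes>) xs \<one>"
  have wl: "word_length G S g = (LEAST n. ?P n)" by (simp add: word_length_def)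
  have "\<exists>n. ?P n" using generate_word[OF assms(1)] assms(2,3) by blast
  then have "?P (word_length G S g)" unfolding wl by (rule LeastI_ex)
  moreover have "word_length G S g \<le> k" if "?P k" for k unfolding wl using that by (rule Least_le)
  ultimately show ?thesis by (metis le_trans)
qed

end

lemma (in group) subexponential_balls_exist:
  assumes "subexponential_growth G"
  obtains B where "subexponential_balls G B"
proof -
  obtain S where S: "finite S" "S \<subseteq> carrier G" "generate G S = carrier G"
    and gr: "\<And>c::real. c > 1 \<Longrightarrow> (\<lambda>n. real (growth G S n)) \<in> o(\<lambda>n. c ^ n)"
    using assms unfolding subexponential_growth_def by auto
  define A where "A = S \<union> (\<lambda>s. inv s) ` S"
  have A: "A \<subseteq> carrier G" "finite A" using S by (auto simp: A_def)
  define B where "B n = {g \<in> carrier G. word_length G S g \<le> n}" for n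
  have B_iff: "g \<in> B n \<longleftrightarrow> (\<exists>xs. length xs \<le> n \<and> set xs \<subseteq> A \<and> g = foldr (\<otimes>) xs \<one>)" for g n
    using word_length_le_iff[OF S(2,3), of g n, folded A_def] foldr_mult_closed A
    by (auto simp: B_def)
  have one: "\<one> \<in> B 0" unfolding B_iff by auto
  have fin: "finite (B n)" for n
  proof -
    have "B n \<subseteq> (\<lambda>xs. foldr (\<otimes>) xs \<one>) ` {xs. set xs \<subseteq> A \<and> length xs \<le> n}"
      using B_iff by auto
    then show ?thesis using finite_lists_length_le[OF A(2)] finite_surj by blast
  qed
  have "subexponential_balls G B"
  proof unfold_locales
    show "B n \<subseteq> carrier G" for n by (auto simp: B_def)
    show "finite (B n)" for n by (rule fin)
    show "\<one> \<in> B 0" by (rule one)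
    show "B m \<subseteq> B n" if "m \<le> n" for m n using that by (auto simp: B_def)
    show "g \<otimes> h \<in> B (m + n)" if gh: "g \<in> B m" "h \<in> B n" for g h m n
    proof -
      obtain xs ys where w: "length xs \<le> m" "set xs \<subseteq> A" "g = foldr (\<otimes>) xs \<one>"
        "length ys \<le> n" "set ys \<subseteq> A" "h = foldr (\<otimes>) ys \<one>" using gh unfolding B_iff by blast
      then show ?thesis unfolding B_iff using foldr_mult_append[of xs ys] A
        by (intro exI[of _ "xs @ ys"]) auto
    qed
    show "inv g \<in> B n" if g: "g \<in> B n" for g n
    proof -
      obtain xs where w: "length xs \<le> n" "set xs \<subseteq> A" "g = foldr (\<otimes>) xs \<one>"
        using g unfolding B_iff by blast
      have "inv x \<in> A" if "x \<in> A" for x using that S(2) by (auto simp: A_def)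
      then show ?thesis unfolding B_iff w(3) using w A inv_foldr_mult[of xs]
        by (intro exI[of _ "rev (map (\<lambda>x. inv x) xs)"]) auto
    qed
    show "\<exists>n. g \<in> B n" if "g \<in> carrier G" for g using that by (auto simp: B_def)
    show "\<exists>n. real (card (B (n + m))) \<le> (1 + e) * real (card (B n))" if "e > 0" for e m
    proof (rule slow_growth)
      show "card (B 0) > 0" using one fin by (auto simp: card_gt_0_iff)
      show "(\<lambda>n. real (card (B n))) \<in> o(\<lambda>n. c ^ n)" if "c > 1" for c
        using gr[OF that] by (simp add: growth_def B_def)
    qed (rule that)
  qed
  then show ?thesis by (rule that)
qed

section \<open>Free actions with finitely many orbits\<close>

definition fin_supp :: "'x set \<Rightarrow> ('x \<Rightarrow> complex) set" where
  "fin_supp X = {f. finite {x. f x \<noteq> 0} \<and> {x. f x \<noteq> 0} \<subseteq> X}"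

lemma fun_on_fin_supp: "finite A \<Longrightarrow> A \<subseteq> X \<Longrightarrow> fun_on A \<subseteq> fin_supp X"
  by (auto simp: fin_supp_def fun_on_def intro: finite_subset)

lemma subspace_fin_supp: "cfun.subspace (fin_supp X)"
proof (rule cfun.subspaceI)
  show "f + h \<in> fin_supp X" if "f \<in> fin_supp X" "h \<in> fin_supp X" for f h
  proof -
    have "{x. (f + h) x \<noteq> 0} \<subseteq> {x. f x \<noteq> 0} \<union> {x. h x \<noteq> 0}" by auto
    moreover have "finite ({x. f x \<noteq> 0} \<union> {x. h x \<noteq> 0})" "{x. f x \<noteq> 0} \<union> {x. h x \<noteq> 0} \<subseteq> X"
      using that by (simp_all add: fin_supp_def)
    ultimately show ?thesis
      unfolding fin_supp_def mem_Collect_eq by (meson finite_subset order_trans)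
  qed
  show "cscale c f \<in> fin_supp X" if "f \<in> fin_supp X" for c f
  proof -
    have "{x. cscale c f x \<noteq> 0} \<subseteq> {x. f x \<noteq> 0}" by auto
    then show ?thesis
      using that unfolding fin_supp_def mem_Collect_eq by (meson finite_subset order_trans)
  qed
qed (simp add: fin_supp_def)

locale free_gset = subexponential_balls G B
  for G :: "('g, 'm) monoid_scheme" (structure) and B +
  fixes X :: "'x set" and act :: "'g \<Rightarrow> 'x \<Rightarrow> 'x" and W :: "'x set"
  assumes act_closed: "g \<in> carrier G \<Longrightarrow> x \<in> X \<Longrightarrow> act g x \<in> X"
    and act_one: "x \<in> X \<Longrightarrow> act \<one> x = x"
    and act_mult: "g \<in> carrier G \<Longrightarrow> h \<in> carrier G \<Longrightarrow> x \<in> X \<Longrightarrow> act (g \<otimes> h) x = act g (act h x)"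
    and W_subset: "W \<subseteq> X" and W_finite: "finite W"
    and W_cover: "x \<in> X \<Longrightarrow> \<exists>g\<in>carrier G. \<exists>w\<in>W. x = act g w"
    and W_free: "g \<in> carrier G \<Longrightarrow> h \<in> carrier G \<Longrightarrow> w \<in> W \<Longrightarrow> w' \<in> W \<Longrightarrow> act g w = act h w'
                   \<Longrightarrow> g = h \<and> w = w'"
begin

definition box :: "nat \<Rightarrow> 'x set" where
  "box n = (\<lambda>(g, w). act g w) ` (B n \<times> W)"

lemma boxI: "g \<in> B n \<Longrightarrow> w \<in> W \<Longrightarrow> act g w \<in> box n"
  by (auto simp: box_def)

lemma boxE:
  assumes "x \<in> box n"
  obtains g w where "g \<in> B n" "w \<in> W" "x = act g w"
  using assms by (auto simp: box_def)

lemma inj_on_box: "inj_on (\<lambda>(g, w). act g w) (B n \<times> W)"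
proof (rule inj_onI, clarsimp)
  fix g w h w' assume "g \<in> B n" "w \<in> W" "h \<in> B n" "w' \<in> W" "act g w = act h w'"
  then show "g = h \<and> w = w'" using W_free[of g h w w'] B_carrier[of n] by (simp add: subset_iff)
qed

lemma box_finite [simp]: "finite (box n)"
  using B_finite W_finite by (simp add: box_def)

lemma box_subset: "box n \<subseteq> X"
proof
  fix x assume "x \<in> box n"
  then show "x \<in> X" using act_closed subsetD[OF B_carrier] subsetD[OF W_subset] by (auto elim!:
      boxE)
qed

lemma box_mono: "m \<le> n \<Longrightarrow> box m \<subseteq> box n"
  unfolding box_def by (intro image_mono Sigma_mono B_mono order_refl)

lemma card_box: "card (box n) = card W * card (B n)"
  using card_image[OF inj_on_box, of n] by (simp add: box_def card_cartesian_product)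

lemma card_box_Diff: "real (card (box (n + m) - box n)) = card W * (real (card (B (n + m))) -
    real (card (B n)))"
  using card_mono[OF box_finite[of "n + m"] box_mono[of n "n + m"]]
  by (simp add: card_Diff_subset box_mono of_nat_diff card_box algebra_simps)

lemma box_exhaust:
  assumes "finite A" "A \<subseteq> X"
  obtains n where "A \<subseteq> box n"
proof -
  have "\<exists>n. x \<in> box n" if "x \<in> X" for x
    using W_cover[OF that] B_exhaust boxI by blast
  then obtain N where N: "\<And>x. x \<in> X \<Longrightarrow> x \<in> box (N x)" by metis
  have "A \<subseteq> box (Max (N ` A))"
  proof
    fix x assume "x \<in> A"
    then have "box (N x) \<subseteq> box (Max (N ` A))" using assms by (intro box_mono) simp
    then show "x \<in> box (Max (N ` A))" using N \<open>x \<in> A\<close> assms by blast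
  qed
  then show ?thesis by (rule that)
qed

lemma fin_supp_iff: "f \<in> fin_supp X \<longleftrightarrow> (\<exists>n. f \<in> fun_on (box n))"
proof
  assume f: "f \<in> fin_supp X"
  obtain n where "{x. f x \<noteq> 0} \<subseteq> box n"
    by (rule box_exhaust[of "{x. f x \<noteq> 0}"]) (use f in \<open>auto simp: fin_supp_def\<close>)
  then show "\<exists>n. f \<in> fun_on (box n)" by (auto simp: fun_on_def)
qed (use fun_on_fin_supp[OF box_finite box_subset] in blast)

lemma act_inv_cancel: "g \<in> carrier G \<Longrightarrow> x \<in> X \<Longrightarrow> act (inv g) (act g x) = x"
  "g \<in> carrier G \<Longrightarrow> x \<in> X \<Longrightarrow> act g (act (inv g) x) = x"
  using act_mult[of "inv g" g x] act_mult[of g "inv g" x] act_one[of x]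
  by (simp_all only: inv_closed l_inv r_inv)

lemma act_bij: "g \<in> carrier G \<Longrightarrow> bij_betw (act g) X X"
  by (rule bij_betw_byWitness[where f' = "act (inv g)"])
    (auto simp: act_inv_cancel act_closed)

lemma translate_act:
  "g \<in> carrier G \<Longrightarrow> x \<in> X \<Longrightarrow> translate G X act g f (act g x) = f x"
  by (simp add: translate_def act_closed act_inv_cancel)

lemma translate_point_mass:
  assumes "g \<in> carrier G" "x \<in> X"
  shows "translate G X act g (point_mass x) = point_mass (act g x)"
  using assms by (auto simp: translate_def point_mass_def fun_eq_iff act_inv_cancel act_closed)

end

locale free_gset_pair = X: free_gset G B X act W + Y: free_gset G B Y act' W'
  for G :: "('g, 'm) monoid_scheme" (structure) and B
    and X :: "'x set" and act W and Y :: "'y set" and act' W'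
begin

lemma finite_range:
  assumes inv: "\<And>g x y. g \<in> carrier G \<Longrightarrow> x \<in> X \<Longrightarrow> y \<in> Y \<Longrightarrow> P x y \<Longrightarrow> P (act g x) (act' g y)"
    and fin: "\<And>x. x \<in> W \<Longrightarrow> finite {y \<in> Y. P x y}"
  obtains m where
    "\<And>n x y. x \<in> X.box n \<Longrightarrow> y \<in> Y \<Longrightarrow> P x y \<Longrightarrow> y \<in> Y.box (n + m)"
    "\<And>n x y. y \<in> Y.box n \<Longrightarrow> x \<in> X \<Longrightarrow> P x y \<Longrightarrow> x \<in> X.box (n + m)"
proof -
  obtain m where m: "(\<Union>x\<in>W. {y \<in> Y. P x y}) \<subseteq> Y.box m"
    by (rule Y.box_exhaust[of "\<Union>x\<in>W. {y \<in> Y. P x y}"]) (use fin X.W_finite in auto)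
  have key: "\<exists>h w'. h \<in> B m \<and> w' \<in> W' \<and> y = act' (g \<otimes> h) w'"
    if "g \<in> carrier G" "w \<in> W" "y \<in> Y" "P (act g w) y" for g w y
  proof -
    have "P (act (inv g) (act g w)) (act' (inv g) y)"
      using that X.W_subset by (intro inv) (auto intro: X.act_closed)
    then have "P w (act' (inv g) y)" using that(1,2) X.W_subset by (simp add: X.act_inv_cancel
        subset_iff)
    moreover have "act' (inv g) y \<in> Y" using that by (simp add: Y.act_closed)
    ultimately have "act' (inv g) y \<in> Y.box m" using m that(2) by blast
    then obtain h w' where h: "h \<in> B m" "w' \<in> W'" "act' (inv g) y = act' h w'" by (rule Y.boxE)
    then have "y = act' g (act' h w')" using Y.act_inv_cancel(2)[of g y] that by simp
    also have "\<dots> = act' (g \<otimes> h) w'"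
      using h that X.B_carrier Y.W_subset by (intro Y.act_mult[symmetric]) auto
    finally show ?thesis using h by blast
  qed
  show ?thesis
  proof
    show "y \<in> Y.box (n + m)" if xy: "x \<in> X.box n" "y \<in> Y" "P x y" for n x y
    proof -
      obtain g w where g: "g \<in> B n" "w \<in> W" "x = act g w" using xy(1) by (rule X.boxE)
      then obtain h w' where h: "h \<in> B m" "w' \<in> W'" "y = act' (g \<otimes> h) w'"
        using key[of g w y] xy X.B_carrier by blast
      then show ?thesis using X.B_mult[OF g(1) h(1)] Y.boxI by simp
    qed
    show "x \<in> X.box (n + m)" if xy: "y \<in> Y.box n" "x \<in> X" "P x y" for n x y
    proof -
      obtain g w where g: "g \<in> carrier G" "w \<in> W" "x = act g w" using X.W_cover[OF xy(2)] by blast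
      obtain k w'' where k: "k \<in> B n" "w'' \<in> W'" "y = act' k w''" using xy(1) by (rule Y.boxE)
      have "y \<in> Y" using xy(1) Y.box_subset by blast
      then obtain h w' where h: "h \<in> B m" "w' \<in> W'" "y = act' (g \<otimes> h) w'"
        using key[OF g(1,2), of y] xy g by blast
      have c: "h \<in> carrier G" "k \<in> carrier G" using h k X.B_carrier by auto
      have "k = g \<otimes> h" using Y.W_free[of k "g \<otimes> h" w'' w'] h k g c by simp
      then have "g = k \<otimes> inv h" using c g by (simp add: X.inv_solve_right)
      then have "g \<in> B (n + m)" using X.B_mult[OF k(1) X.B_inv[OF h(1)]] by simp
      then show ?thesis using X.boxI g by simp
    qed
  qed
qed

end

locale equivariant_map = free_gset_pair G B X act W Y act' W'
  for G :: "('g, 'm) monoid_scheme" (structure) and B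
    and X :: "'x set" and act W and Y :: "'y set" and act' W' +
  fixes T :: "('x \<Rightarrow> complex) \<Rightarrow> 'y \<Rightarrow> complex"
  assumes T_fin_supp: "f \<in> fin_supp X \<Longrightarrow> T f \<in> fin_supp Y"
    and T_add: "f \<in> fin_supp X \<Longrightarrow> h \<in> fin_supp X \<Longrightarrow> T (f + h) = T f + T h"
    and T_scale: "f \<in> fin_supp X \<Longrightarrow> T (cscale c f) = cscale c (T f)"
    and T_translate: "g \<in> carrier G \<Longrightarrow> f \<in> fin_supp X \<Longrightarrow>
      T (translate G X act g f) = translate G Y act' g (T f)"
begin

lemma T_zero: "T 0 = 0"
  using T_scale[OF cfun.subspace_0[OF subspace_fin_supp], of 0] by (simp add: cscale_def
      zero_fun_def)

lemma T_sum:
  "(\<And>i. i \<in> I \<Longrightarrow> f i \<in> fin_supp X) \<Longrightarrow> T (\<Sum>i\<in>I. f i) = (\<Sum>i\<in>I. T (f i))"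
proof (induction I rule: infinite_finite_induct)
  case (insert i I)
  then have "T (f i + (\<Sum>i\<in>I. f i)) = T (f i) + T (\<Sum>i\<in>I. f i)"
    by (intro T_add cfun.subspace_sum[OF subspace_fin_supp]) auto
  with insert show ?case by (metis insertCI sum.insert)
qed (simp_all only: sum.infinite sum.empty T_zero not_False_eq_True)

lemma T_expand:
  assumes "finite A" "A \<subseteq> X" "f \<in> fun_on A"
  shows "T f y = (\<Sum>x\<in>A. f x * T (point_mass x) y)"
proof -
  have pm: "point_mass x \<in> fin_supp X" if "x \<in> A" for x
    using that point_mass_fun_on[of x A] fun_on_fin_supp[OF assms(1,2)] by blast
  have "T f = T (\<Sum>x\<in>A. cscale (f x) (point_mass x))"
    using fun_on_expand[OF assms(1,3)] by (rule arg_cong)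
  also have "\<dots> = (\<Sum>x\<in>A. T (cscale (f x) (point_mass x)))"
    by (intro T_sum cfun.subspace_scale[OF subspace_fin_supp] pm)
  also have "\<dots> = (\<Sum>x\<in>A. cscale (f x) (T (point_mass x)))"
    by (intro sum.cong refl T_scale pm)
  finally show ?thesis by (simp only: sum_cscale_apply)
qed

lemma T_range:
  obtains m where
    "\<And>n f. f \<in> fun_on (X.box n) \<Longrightarrow> T f \<in> fun_on (Y.box (n + m))"
    "\<And>n f y. f \<in> fin_supp X \<Longrightarrow> y \<in> Y.box n \<Longrightarrow> T (restrict_support (X.box (n + m)) f) y = T f y"
proof -
  have pm: "point_mass x \<in> fin_supp X" if "x \<in> X" for x
    using that point_mass_fun_on[of x "{x}"] fun_on_fin_supp[of "{x}" X] by auto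
  obtain m where m:
    "\<And>n x y. x \<in> X.box n \<Longrightarrow> y \<in> Y \<Longrightarrow> T (point_mass x) y \<noteq> 0 \<Longrightarrow> y \<in> Y.box (n + m)"
    "\<And>n x y. y \<in> Y.box n \<Longrightarrow> x \<in> X \<Longrightarrow> T (point_mass x) y \<noteq> 0 \<Longrightarrow> x \<in> X.box (n + m)"
  proof (rule finite_range[of "\<lambda>x y. T (point_mass x) y \<noteq> 0"])
    show "T (point_mass (act g x)) (act' g y) \<noteq> 0"
      if "g \<in> carrier G" "x \<in> X" "y \<in> Y" "T (point_mass x) y \<noteq> 0" for g x y
      using T_translate[OF that(1) pm[OF that(2)]] that
      by (simp add: X.translate_point_mass Y.translate_act)
    show "finite {y \<in> Y. T (point_mass x) y \<noteq> 0}" if "x \<in> W" for x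
      using T_fin_supp[OF pm[of x]] that X.W_subset by (auto simp: fin_supp_def elim:
          rev_finite_subset)
  qed blast
  show ?thesis
  proof
    show "T f \<in> fun_on (Y.box (n + m))" if f: "f \<in> fun_on (X.box n)" for n f
    proof -
      have "T f y = 0" if "y \<notin> Y.box (n + m)" for y
      proof (cases "y \<in> Y")
        case True
        then show ?thesis unfolding T_expand[OF X.box_finite X.box_subset f]
          using m(1) that by (intro sum.neutral) auto
      next
        case False
        have "f \<in> fin_supp X" using f X.fin_supp_iff by blast
        then show ?thesis using T_fin_supp[of f] False by (auto simp: fin_supp_def)
      qed
      then show ?thesis by (simp add: fun_on_def)
    qed
    show "T (restrict_support (X.box (n + m)) f) y = T f y" if f: "f \<in> fin_supp X" and y: "y \<in>
        Y.box n" for n f y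
    proof -
      obtain k where "f \<in> fun_on (X.box k)" using f X.fin_supp_iff by blast
      then have fk: "f \<in> fun_on (X.box (max k (n + m)))"
        using fun_on_mono[OF X.box_mono[of k "max k (n + m)"]] by auto
      have sub: "X.box (n + m) \<subseteq> X.box (max k (n + m))" by (rule X.box_mono) simp
      have "T f y = (\<Sum>x\<in>X.box (max k (n + m)). f x * T (point_mass x) y)"
        by (rule T_expand[OF X.box_finite X.box_subset fk])
      also have "\<dots> = (\<Sum>x\<in>X.box (n + m). f x * T (point_mass x) y)"
        using m(2)[OF y] X.box_subset by (intro sum.mono_neutral_right sub) auto
      also have "\<dots> = (\<Sum>x\<in>X.box (n + m). restrict_support (X.box (n + m)) f x * T (point_mass x) y)"
        by (simp add: restrict_support_def)
      also have "\<dots> = T (restrict_support (X.box (n + m)) f) y"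
        by (rule T_expand[OF X.box_finite X.box_subset restrict_support_fun_on, symmetric])
      finally show ?thesis by simp
    qed
  qed
qed

lemma subspace_image: "cfun.subspace (T ` fin_supp X)"
proof (rule cfun.subspaceI)
  show "0 \<in> T ` fin_supp X"
    using T_zero[symmetric] cfun.subspace_0[OF subspace_fin_supp] by (rule image_eqI)
  show "x + y \<in> T ` fin_supp X" if xy: "x \<in> T ` fin_supp X" "y \<in> T ` fin_supp X" for x y
  proof -
    obtain f h where f: "f \<in> fin_supp X" "h \<in> fin_supp X" "x = T f" "y = T h" using xy by blast
    show ?thesis unfolding f(3,4) T_add[OF f(1,2), symmetric]
      by (intro imageI cfun.subspace_add[OF subspace_fin_supp] f)
  qed
  show "cscale c x \<in> T ` fin_supp X" if x: "x \<in> T ` fin_supp X" for c x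
  proof -
    obtain f where f: "f \<in> fin_supp X" "x = T f" using x by blast
    show ?thesis unfolding f(2) T_scale[OF f(1), symmetric]
      by (intro imageI cfun.subspace_scale[OF subspace_fin_supp] f)
  qed
qed

text \<open>Locality makes the restriction of \<open>T\<close> to a box see all of \<open>T ` fin_supp X\<close> on a slightly
  smaller box, so no control on the size of preimages is needed.\<close>

lemma dim_image_kernel:
  obtains m where "\<And>n. \<bar>real (cfun.dim (T ` fin_supp X \<inter> fun_on (Y.box n)))
      + real (cfun.dim ({f \<in> fin_supp X. T f = 0} \<inter> fun_on (X.box n))) - card W * real (card (B n))\<bar>
    \<le> (card W + card W') * (real (card (B (n + m))) - real (card (B n)))"
proof -
  obtain m where loc:
    "\<And>n f. f \<in> fun_on (X.box n) \<Longrightarrow> T f \<in> fun_on (Y.box (n + m))"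
    "\<And>n f y. f \<in> fin_supp X \<Longrightarrow> y \<in> Y.box n \<Longrightarrow> T (restrict_support (X.box (n + m)) f) y = T f y"
    by (rule T_range) blast
  have fch: "fun_on (X.box n) \<subseteq> fin_supp X" for n using X.fin_supp_iff by blast
  show ?thesis
  proof
    fix n
    let ?M = "T ` fin_supp X" and ?K = "{f \<in> fin_supp X. T f = 0}"
    let ?b = "real (card (B (n + m))) - real (card (B n))"
    have b: "?b \<ge> 0" using card_mono[OF X.B_finite X.B_mono[of n "n + m"]] by simp
    have "card W * real (card (B n)) \<le> cfun.dim (?M \<inter> fun_on (Y.box n)) + cfun.dim (?K \<inter> fun_on
        (X.box n)) + card W' * ?b"
    proof -
      have "cfun.dim (T ` fun_on (X.box n)) + cfun.dim {f \<in> fun_on (X.box n). T f = 0} = cfun.dim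
          (fun_on (X.box n))"
        by (rule rank_nullity[OF subspace_fun_on order_refl X.box_finite])
          (use fch T_add T_scale in blast)+
      moreover have ker: "{f \<in> fun_on (X.box n). T f = 0} = ?K \<inter> fun_on (X.box n)" using fch by
          blast
      moreover have "cfun.dim (T ` fun_on (X.box n)) \<le> cfun.dim (?M \<inter> fun_on (Y.box (n + m)))"
        by (rule dim_mono[OF _ Int_lower2 Y.box_finite]) (use loc(1) fch in blast)
      moreover have "cfun.dim (?M \<inter> fun_on (Y.box (n + m)))
          \<le> cfun.dim (?M \<inter> fun_on (Y.box (n + m)) \<inter> fun_on (Y.box n)) + card (Y.box (n + m) -
              Y.box n)"
        by (rule dim_le_dim_Int_fun_on[OF _ Int_lower2 Y.box_finite])
          (intro cfun.subspace_inter subspace_image subspace_fun_on)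
      moreover have int: "?M \<inter> fun_on (Y.box (n + m)) \<inter> fun_on (Y.box n) = ?M \<inter> fun_on (Y.box n)"
        using fun_on_mono[OF Y.box_mono[of n "n + m"]] by auto
      ultimately have "card (X.box n) \<le> cfun.dim (?M \<inter> fun_on (Y.box n)) + cfun.dim (?K \<inter> fun_on
          (X.box n))
          + card (Y.box (n + m) - Y.box n)"
        unfolding dim_fun_on[OF X.box_finite] ker int by linarith
      then have "real (card (X.box n)) \<le> real (cfun.dim (?M \<inter> fun_on (Y.box n))) + real (cfun.dim
          (?K \<inter> fun_on (X.box n)))
          + real (card (Y.box (n + m) - Y.box n))" by linarith
      then show ?thesis unfolding X.card_box Y.card_box_Diff by simp
    qed
    moreover have "cfun.dim (?M \<inter> fun_on (Y.box n)) + cfun.dim (?K \<inter> fun_on (X.box n)) \<le> card W *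
        real (card (B (n + m)))"
    proof -
      define T' where "T' f = restrict_support (Y.box n) (T f)" for f
      have T'add: "T' (f + h) = T' f + T' h" if "f \<in> fin_supp X" "h \<in> fin_supp X" for f h
        using T_add[OF that] by (auto simp: T'_def restrict_support_def fun_eq_iff)
      have T'scale: "T' (cscale c f) = cscale c (T' f)" if "f \<in> fin_supp X" for c f
        using T_scale[OF that, of c] by (auto simp: T'_def restrict_support_def fun_eq_iff)
      have "cfun.dim (T' ` fun_on (X.box (n + m))) + cfun.dim {f \<in> fun_on (X.box (n + m)). T' f = 0}
          = cfun.dim (fun_on (X.box (n + m)))"
        by (rule rank_nullity[OF subspace_fun_on order_refl X.box_finite])
          (use fch T'add T'scale in blast)+
      moreover have "cfun.dim (?K \<inter> fun_on (X.box n)) \<le> cfun.dim {f \<in> fun_on (X.box (n + m)). T'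
          f = 0}"
      proof (rule dim_mono[OF _ _ X.box_finite])
        have "T' f = 0" if "T f = 0" for f using that by (auto simp: T'_def restrict_support_def)
        then show "?K \<inter> fun_on (X.box n) \<subseteq> {f \<in> fun_on (X.box (n + m)). T' f = 0}"
          using fun_on_mono[OF X.box_mono[of n "n + m"]] by auto
      qed blast
      moreover have "cfun.dim (?M \<inter> fun_on (Y.box n)) \<le> cfun.dim (T' ` fun_on (X.box (n + m)))"
      proof (rule dim_mono[OF _ _ Y.box_finite])
        show "T' ` fun_on (X.box (n + m)) \<subseteq> fun_on (Y.box n)"
          using restrict_support_fun_on by (auto simp: T'_def)
        show "?M \<inter> fun_on (Y.box n) \<subseteq> T' ` fun_on (X.box (n + m))"
        proof
          fix y assume y: "y \<in> ?M \<inter> fun_on (Y.box n)"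
          then obtain f where f: "f \<in> fin_supp X" "y = T f" by blast
          have "T' (restrict_support (X.box (n + m)) f) = restrict_support (Y.box n) (T f)"
            using loc(2)[OF f(1)] by (auto simp: T'_def restrict_support_def fun_eq_iff)
          also have "\<dots> = y" using restrict_support_idem y f by auto
          finally show "y \<in> T' ` fun_on (X.box (n + m))" using restrict_support_fun_on by blast
        qed
      qed
      ultimately have "cfun.dim (?M \<inter> fun_on (Y.box n)) + cfun.dim (?K \<inter> fun_on (X.box n)) \<le> card
          (X.box (n + m))"
        unfolding dim_fun_on[OF X.box_finite] by linarith
      then have "real (cfun.dim (?M \<inter> fun_on (Y.box n)) + cfun.dim (?K \<inter> fun_on (X.box n))) \<le>
          real (card (X.box (n + m)))"
        by (simp only: of_nat_le_iff)
      then show ?thesis unfolding X.card_box by simp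
    qed
    moreover have "0 \<le> card W * ?b" "0 \<le> card W' * ?b" using b by simp_all
    ultimately show "\<bar>real (cfun.dim (?M \<inter> fun_on (Y.box n))) + real (cfun.dim (?K \<inter> fun_on
        (X.box n)))
        - card W * real (card (B n))\<bar> \<le> (card W + card W') * ?b"
      by (simp only: of_nat_add distrib_right right_diff_distrib)
  qed
qed

end

section \<open>The density of states of a local kernel\<close>

context reproducing_kernel
begin

lemma eq_kernel:
  assumes "v \<in> V" "f \<in> H" "\<And>h. h \<in> H \<Longrightarrow> ell2_inner V h f = cnj (h v)"
  shows "f = p v"
proof -
  have d: "f - p v \<in> H" by (rule cfun.subspace_diff[OF subspace_H assms(2) kernel_in_H[OF
      assms(1)]])
  have "ell2_inner V (f - p v) (f - p v) = ell2_inner V (f - p v) f - ell2_inner V (f - p v) (p v)"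
    by (rule ell2_inner_diff_right) (use d H_ell2 assms(2) kernel_in_H[OF assms(1)] in blast)+
  also have "\<dots> = 0" using assms(3)[OF d] reproducing[OF assms(1) d] by simp
  finally have "ell2_sqnorm V (f - p v) = 0"
    using ell2_inner_self[OF subsetD[OF H_ell2 d]] by simp
  then have "f - p v = 0" using ell2_sqnorm_eq_0[OF subsetD[OF H_ell2 d]] by simp
  then show ?thesis by (simp only: right_minus_eq)
qed

lemma projection_point_mass:
  assumes "v \<in> V"
  shows "orthogonal_projection V H (point_mass v) = p v"
proof -
  have pm: "point_mass v \<in> ell2 V"
    using fun_on_ell2[of "{v}" V] point_mass_fun_on[of v "{v}"] assms by auto
  have ip: "ell2_inner V h (\<lambda>u. point_mass v u - f u) = cnj (h v) - ell2_inner V h f"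
    if "h \<in> H" "f \<in> H" for h f
    using ell2_inner_diff_right[of h V "point_mass v" f] that pm H_ell2
      ell2_inner_point_mass_right[OF assms, of h] by (auto simp: fun_diff_def)
  show ?thesis
    unfolding orthogonal_projection_def
  proof (rule the_equality)
    show "p v \<in> H \<and> (\<forall>h\<in>H. ell2_inner V h (\<lambda>u. point_mass v u - p v u) = 0)"
      using kernel_in_H[OF assms] ip reproducing[OF assms] by simp
    show "f = p v" if "f \<in> H \<and> (\<forall>h\<in>H. ell2_inner V h (\<lambda>u. point_mass v u - f u) = 0)" for f
      using that ip by (intro eq_kernel[OF assms]) auto
  qed
qed

lemma projection_zero: "orthogonal_projection V H (\<lambda>_. 0) = (\<lambda>_. 0)"
  unfolding orthogonal_projection_def
proof (rule the_equality)
  show "(\<lambda>_. 0) \<in> H \<and> (\<forall>h\<in>H. ell2_inner V h (\<lambda>v. 0 - 0) = 0)"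
    using cfun.subspace_0[OF subspace_H] by (simp add: zero_fun_def ell2_inner_def)
  fix f assume f: "f \<in> H \<and> (\<forall>h\<in>H. ell2_inner V h (\<lambda>v. 0 - f v) = 0)"
  then have "ell2_inner V f (- f) = 0" by (simp add: fun_Compl_def)
  then have "ell2_sqnorm V f = 0"
    using ell2_inner_self[of f V] f H_ell2 by (auto simp: ell2_inner_minus_right)
  then have "f = 0" using ell2_sqnorm_eq_0[of f V] f H_ell2 by auto
  then show "f = (\<lambda>_. 0)" by (simp add: zero_fun_def)
qed

lemma operator_trace_projection:
  assumes "finite W" "W \<subseteq> V"
  shows "operator_trace V (\<lambda>f. orthogonal_projection V H (restrict_support W f)) = (\<Sum>w\<in>W. p w w)"
proof -
  have "restrict_support W (point_mass v) = (if v \<in> W then point_mass v else (\<lambda>_. 0))" for v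
    by (auto simp: restrict_support_def point_mass_def fun_eq_iff)
  then have "ell2_inner V (point_mass v) (orthogonal_projection V H (restrict_support W
      (point_mass v)))
      = (if v \<in> W then p v v else 0)" if "v \<in> V" for v
    using that by (simp add: ell2_inner_point_mass_left projection_point_mass projection_zero)
  then have "operator_trace V (\<lambda>f. orthogonal_projection V H (restrict_support W f))
      = (\<Sum>\<^sub>\<infinity>v\<in>V. if v \<in> W then p v v else 0)"
    unfolding operator_trace_def by (rule infsum_cong)
  also have "\<dots> = (\<Sum>\<^sub>\<infinity>v\<in>W. p v v)"
    by (rule infsum_cong_neutral) (use assms in auto)
  finally show ?thesis using assms(1) by simp
qed

end

locale local_kernel = free_gset G B X act W
  for G :: "('g, 'm) monoid_scheme" (structure) and B and X :: "'x set" and act W +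
  fixes a :: "'x \<Rightarrow> 'x \<Rightarrow> complex"
  assumes a_invariant: "g \<in> carrier G \<Longrightarrow> x \<in> X \<Longrightarrow> y \<in> X \<Longrightarrow> a (act g x) (act g y) = a x y"
    and a_finite: "x \<in> X \<Longrightarrow> finite {y \<in> X. a x y \<noteq> 0}"
begin

definition apply_kernel :: "('x \<Rightarrow> complex) \<Rightarrow> 'x \<Rightarrow> complex" where
  "apply_kernel f x = (\<Sum>y | y \<in> X \<and> a x y \<noteq> 0. a x y * f y)"

definition ker2 :: "('x \<Rightarrow> complex) set" where
  "ker2 = {f \<in> ell2 X. \<forall>x\<in>X. apply_kernel f x = 0}"

lemma ker2_ell2: "ker2 \<subseteq> ell2 X"
  by (auto simp: ker2_def)

lemma subspace_ker2: "cfun.subspace ker2"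
proof (rule cfun.subspaceI)
  show "0 \<in> ker2" using cfun.subspace_0[OF subspace_ell2] by (simp add: ker2_def apply_kernel_def)
  show "f + h \<in> ker2" if "f \<in> ker2" "h \<in> ker2" for f h
  proof -
    have "apply_kernel (f + h) x = apply_kernel f x + apply_kernel h x" for x
      by (simp add: apply_kernel_def distrib_left sum.distrib)
    then show ?thesis using that ell2_add[of f X h] by (simp add: ker2_def del: plus_fun_apply)
  qed
  show "cscale c f \<in> ker2" if "f \<in> ker2" for c f
  proof -
    have "apply_kernel (cscale c f) x = c * apply_kernel f x" for x
      by (simp add: apply_kernel_def sum_distrib_left mult_ac)
    then show ?thesis using that ell2_scale[of f X c] by (simp add: ker2_def del: cscale_apply)
  qed
qed

lemma ker2_closed:
  assumes "\<And>n::nat. F n \<in> ker2" "f \<in> ell2 X" "\<And>x. (\<lambda>n. F n x) \<longlonglongrightarrow> f x"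
  shows "f \<in> ker2"
proof -
  have "apply_kernel f x = 0" if "x \<in> X" for x
  proof -
    have "(\<lambda>n. apply_kernel (F n) x) \<longlonglongrightarrow> apply_kernel f x"
      unfolding apply_kernel_def by (intro tendsto_intros assms(3))
    moreover have "(\<lambda>n. apply_kernel (F n) x) \<longlonglongrightarrow> 0"
      using assms(1) that by (simp add: ker2_def)
    ultimately show ?thesis by (rule LIMSEQ_unique)
  qed
  then show ?thesis using assms(2) by (simp add: ker2_def)
qed

lemma translate_ell2:
  assumes "g \<in> carrier G" "f \<in> ell2 X"
  shows "translate G X act g f \<in> ell2 X"
proof -
  have "(\<lambda>x. (cmod (f (act (inv g) x)))\<^sup>2) summable_on X"
    using summable_on_reindex_bij_betw[OF act_bij[of "inv g"], of "\<lambda>x. (cmod (f x))\<^sup>2"] assms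
    by (simp add: ell2_def)
  then have "(\<lambda>x. (cmod (translate G X act g f x))\<^sup>2) summable_on X"
    by (rule summable_on_cong[THEN iffD1, rotated]) (simp add: translate_def)
  then show ?thesis by (simp add: ell2_def translate_def)
qed

lemma ell2_inner_translate:
  assumes "g \<in> carrier G"
  shows "ell2_inner X h (translate G X act g f) = ell2_inner X (translate G X act (inv g) h) f"
proof -
  have "ell2_inner X h (translate G X act g f)
      = (\<Sum>\<^sub>\<infinity>x\<in>X. cnj (h (act g x)) * translate G X act g f (act g x))"
    unfolding ell2_inner_def
    by (rule infsum_reindex_bij_betw[OF act_bij[OF assms], symmetric])
  also have "\<dots> = ell2_inner X (translate G X act (inv g) h) f"
    unfolding ell2_inner_def
    by (rule infsum_cong) (use assms in \<open>simp add: translate_act\<close>, simp add: translate_def)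
  finally show ?thesis .
qed

lemma apply_kernel_translate:
  assumes "g \<in> carrier G" "x \<in> X"
  shows "apply_kernel (translate G X act g f) (act g x) = apply_kernel f x"
proof -
  have set: "{y \<in> X. a (act g x) y \<noteq> 0} = act g ` {y \<in> X. a x y \<noteq> 0}"
  proof (intro equalityI subsetI)
    fix y assume y: "y \<in> {y \<in> X. a (act g x) y \<noteq> 0}"
    then have "y = act g (act (inv g) y)" "act (inv g) y \<in> X"
      using assms by (simp_all add: act_inv_cancel act_closed)
    then show "y \<in> act g ` {y \<in> X. a x y \<noteq> 0}"
      using y a_invariant[OF assms, of "act (inv g) y"] by (intro image_eqI) auto
  qed (use assms a_invariant act_closed in auto)
  have inj: "inj_on (act g) {y \<in> X. a x y \<noteq> 0}"
    by (rule inj_on_subset[OF bij_betw_imp_inj_on[OF act_bij[OF assms(1)]]]) auto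
  show ?thesis
    unfolding apply_kernel_def set sum.reindex[OF inj]
    by (rule sum.cong) (use assms a_invariant in \<open>auto simp: translate_act\<close>)
qed

lemma translate_ker2:
  assumes "g \<in> carrier G" "f \<in> ker2"
  shows "translate G X act g f \<in> ker2"
proof -
  have "apply_kernel (translate G X act g f) x = 0" if "x \<in> X" for x
  proof -
    have "apply_kernel (translate G X act g f) (act g (act (inv g) x)) = apply_kernel f (act (inv
        g) x)"
      by (rule apply_kernel_translate) (use assms that act_closed in auto)
    also have "\<dots> = 0" using assms that act_closed by (simp add: ker2_def)
    finally show ?thesis using assms that by (simp add: act_inv_cancel)
  qed
  then show ?thesis using translate_ell2 assms by (simp add: ker2_def)
qed

lemma reproducing_kernel_exists:
  obtains p where "reproducing_kernel X ker2 p"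
proof -
  have "\<exists>p\<in>ker2. \<forall>h\<in>ker2. ell2_inner X h p = cnj (h x)" if x: "x \<in> X" for x
  proof -
    have pm: "point_mass x \<in> ell2 X"
      using fun_on_ell2[of "{x}" X] point_mass_fun_on[of x "{x}"] x by auto
    show ?thesis
    proof (rule projection_exists[OF subspace_ker2 ker2_ell2 _ pm])
      fix p assume p: "p \<in> ker2" "\<And>h. h \<in> ker2 \<Longrightarrow> ell2_inner X h (point_mass x - p) = 0"
      have "ell2_inner X h p = cnj (h x)" if h: "h \<in> ker2" for h
        using ell2_inner_diff_right[OF subsetD[OF ker2_ell2 h] pm subsetD[OF ker2_ell2 p(1)]]
            p(2)[OF h]
          ell2_inner_point_mass_right[OF x, of h] by simp
      then show ?thesis using p(1) by blast
    qed (rule ker2_closed)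
  qed
  then obtain p where "\<And>x. x \<in> X \<Longrightarrow> p x \<in> ker2 \<and> (\<forall>h\<in>ker2. ell2_inner X h (p x) = cnj (h x))"
    by metis
  then have "reproducing_kernel X ker2 p"
    using subspace_ker2 ker2_ell2 by unfold_locales auto
  then show ?thesis by (rule that)
qed

lemma kernel_invariant:
  assumes "reproducing_kernel X ker2 p" "g \<in> carrier G" "x \<in> X"
  shows "p (act g x) (act g x) = p x x"
proof -
  interpret reproducing_kernel X ker2 p by (rule assms(1))
  have "translate G X act g (p x) = p (act g x)"
  proof (rule eq_kernel)
    show "act g x \<in> X" by (rule act_closed[OF assms(2,3)])
    show "translate G X act g (p x) \<in> ker2" by (rule translate_ker2[OF assms(2) kernel_in_H[OF
        assms(3)]])
    show "ell2_inner X h (translate G X act g (p x)) = cnj (h (act g x))" if "h \<in> ker2" for h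
      unfolding ell2_inner_translate[OF assms(2)]
      using reproducing[OF assms(3) translate_ker2[OF inv_closed[OF assms(2)] that]] assms(2,3)
      by (simp add: translate_def)
  qed
  then show ?thesis using translate_act[OF assms(2,3), of "p x"] by simp
qed

text \<open>An element of \<open>ker2\<close> that vanishes on the thick boundary of a box can be cut off at the
  box and stays in \<open>ker2\<close>.\<close>

lemma cut_off_ker2:
  obtains m where
    "\<And>n. restrict_support (box (n + m)) ` ker2 \<inter> fun_on (box n) \<subseteq> ker2 \<inter> fun_on (box n)"
proof -
  interpret free_gset_pair G B X act W X act W ..
  obtain m where m: "\<And>n x y. x \<in> box n \<Longrightarrow> y \<in> X \<Longrightarrow> a x y \<noteq> 0 \<Longrightarrow> y \<in> box (n + m)"
    "\<And>n x y. y \<in> box n \<Longrightarrow> x \<in> X \<Longrightarrow> a x y \<noteq> 0 \<Longrightarrow> x \<in> box (n + m)"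
    by (rule finite_range[of "\<lambda>x y. a x y \<noteq> 0"]) (use a_invariant a_finite W_subset in auto)
  have "restrict_support (box (n + (m + m))) ` ker2 \<inter> fun_on (box n) \<subseteq> ker2 \<inter> fun_on (box n)" for n
  proof
    fix u assume "u \<in> restrict_support (box (n + (m + m))) ` ker2 \<inter> fun_on (box n)"
    then obtain f where f: "f \<in> ker2" "u = restrict_support (box (n + (m + m))) f" and u: "u \<in>
        fun_on (box n)"
      by blast
    have "apply_kernel u x = 0" if x: "x \<in> X" for x
    proof (cases "\<exists>y\<in>box n. a x y \<noteq> 0")
      case True
      then have "x \<in> box (n + m)" using m(2) x by blast
      then have "y \<in> box (n + (m + m))" if "y \<in> X" "a x y \<noteq> 0" for y
        using m(1)[of x "n + m" y] that by (simp add: add.assoc)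
      then have "apply_kernel u x = apply_kernel f x"
        unfolding apply_kernel_def f(2) by (intro sum.cong) (auto simp: restrict_support_def)
      then show ?thesis using f(1) x by (simp add: ker2_def)
    next
      case False
      then show ?thesis
        unfolding apply_kernel_def using fun_onD[OF u] by (intro sum.neutral) auto
    qed
    moreover have "u \<in> ell2 X" using u fun_on_ell2[OF box_finite box_subset] by blast
    ultimately show "u \<in> ker2 \<inter> fun_on (box n)" using u by (simp add: ker2_def)
  qed
  then show ?thesis by (rule that)
qed

lemma density_estimate:
  assumes "reproducing_kernel X ker2 p"
  obtains m where "\<And>n. \<bar>(\<Sum>w\<in>W. Re (p w w)) * real (card (B n)) - real (cfun.dim (ker2 \<inter> fun_on
      (box n)))\<bar>
    \<le> card W * (real (card (B (n + m))) - real (card (B n)))"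
proof -
  interpret reproducing_kernel X ker2 p by (rule assms)
  define \<tau> where "\<tau> = (\<Sum>w\<in>W. Re (p w w))"
  have "Re (p x x) \<ge> 0" if "x \<in> X" for x
    using arg_cong[OF sqnorm_kernel[OF that], of Re] ell2_sqnorm_nonneg[of X "p x"] by simp
  then have "\<tau> \<ge> 0" unfolding \<tau>_def using W_subset by (intro sum_nonneg) auto
  have trace: "(\<Sum>v\<in>box n. Re (p v v)) = \<tau> * real (card (B n))" for n
  proof -
    have "(\<Sum>v\<in>box n. Re (p v v)) = (\<Sum>(g, w)\<in>B n \<times> W. Re (p (act g w) (act g w)))"
      unfolding box_def sum.reindex[OF inj_on_box] by (simp add: case_prod_unfold)
    also have "\<dots> = (\<Sum>(g, w)\<in>B n \<times> W. Re (p w w))"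
      using kernel_invariant[OF assms subsetD[OF B_carrier] subsetD[OF W_subset]]
      by (intro sum.cong) auto
    also have "\<dots> = \<tau> * real (card (B n))"
      by (simp add: sum.cartesian_product[symmetric] \<tau>_def mult.commute)
    finally show ?thesis .
  qed
  obtain m where m: "\<And>n. restrict_support (box (n + m)) ` ker2 \<inter> fun_on (box n) \<subseteq> ker2 \<inter> fun_on
      (box n)"
    by (rule cut_off_ker2) blast
  show ?thesis
  proof
    fix n
    let ?b = "real (card (B (n + m))) - real (card (B n))"
    have lower: "real (cfun.dim (ker2 \<inter> fun_on (box n))) \<le> \<tau> * real (card (B n))"
      unfolding trace[symmetric]
      by (rule dim_le_trace) (use box_subset in \<open>auto intro: cfun.subspace_inter subspace_ker2
          subspace_fun_on\<close>)
    let ?U = "restrict_support (box (n + m)) ` ker2"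
    have "cfun.dim ?U \<le> cfun.dim (?U \<inter> fun_on (box n)) + card (box (n + m) - box n)"
    proof (rule dim_le_dim_Int_fun_on)
      show "cfun.subspace ?U" by (rule subspace_restrict[OF subspace_ker2])
      show "?U \<subseteq> fun_on (box (n + m))" using restrict_support_fun_on by blast
    qed simp
    also have "cfun.dim (?U \<inter> fun_on (box n)) \<le> cfun.dim (ker2 \<inter> fun_on (box n))"
      by (rule dim_mono[OF m Int_lower2 box_finite])
    finally have "real (cfun.dim ?U) \<le> real (cfun.dim (ker2 \<inter> fun_on (box n))) + real (card (box
        (n + m) - box n))"
      by linarith
    moreover have "\<tau> * real (card (B (n + m))) \<le> real (cfun.dim ?U)"
      unfolding trace[symmetric] by (rule trace_le_dim[OF box_finite box_subset])
    moreover have "\<tau> * real (card (B n)) \<le> \<tau> * real (card (B (n + m)))"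
      using \<open>\<tau> \<ge> 0\<close> card_mono[OF B_finite B_mono[of n "n + m"]] by (intro mult_left_mono) auto
    ultimately show "\<bar>(\<Sum>w\<in>W. Re (p w w)) * real (card (B n)) - real (cfun.dim (ker2 \<inter> fun_on (box
        n)))\<bar> \<le> card W * ?b"
      using lower unfolding card_box_Diff \<tau>_def by linarith
  qed
qed

end

section \<open>Periodic operators of finite order as local kernels\<close>

lemma linear_operator_sum:
  assumes D: "linear_operator_on_ell2 V D" and "finite A" "A \<subseteq> V" "f \<in> fun_on A"
  shows "D f v = (\<Sum>w\<in>A. D (point_mass w) v * f w)"
proof -
  have pm: "point_mass w \<in> ell2 V" if "w \<in> V" for w
    using fun_on_ell2[of "{w}" V] point_mass_fun_on[of w "{w}"] that by auto
  have Dadd: "D (\<lambda>v. f v + h v) = (\<lambda>v. D f v + D h v)" if "f \<in> ell2 V" "h \<in> ell2 V" for f h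
    using D that unfolding linear_operator_on_ell2_def by blast
  have Dscale: "D (\<lambda>v. c * f v) = (\<lambda>v. c * D f v)" if "f \<in> ell2 V" for c f
    using D that unfolding linear_operator_on_ell2_def by blast
  have D0: "D (\<lambda>_. 0) = (\<lambda>_. 0)"
  proof -
    have z: "(\<lambda>_. 0) \<in> ell2 V" by (simp add: ell2_def)
    from Dscale[OF z, of 0] show ?thesis by simp
  qed
  have "D (\<lambda>x. \<Sum>w\<in>A. f w * point_mass w x) = (\<lambda>v. \<Sum>w\<in>A. f w * D (point_mass w) v)"
    using assms(2,3)
  proof (induction A)
    case (insert w A)
    have "(\<lambda>x. \<Sum>w\<in>A. f w * point_mass w x) \<in> fun_on A"
      by (auto simp: fun_on_def point_mass_def intro!: sum.neutral)
    then have 1: "(\<lambda>x. \<Sum>w\<in>A. f w * point_mass w x) \<in> ell2 V"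
      using fun_on_ell2[of A V] insert by auto
    have 2: "(\<lambda>x. f w * point_mass w x) \<in> ell2 V"
      using ell2_scale[OF pm[of w], of "f w"] insert by (simp add: cscale_def)
    have 3: "D (\<lambda>x. f w * point_mass w x) = (\<lambda>v. f w * D (point_mass w) v)"
      by (rule Dscale) (use pm insert in auto)
    have "D (\<lambda>x. f w * point_mass w x + (\<Sum>w\<in>A. f w * point_mass w x))
        = (\<lambda>v. D (\<lambda>x. f w * point_mass w x) v + D (\<lambda>x. \<Sum>w\<in>A. f w * point_mass w x) v)"
      by (rule Dadd[OF 2 1])
    then show ?case using insert 3 by simp
  qed (simp add: D0)
  moreover have "(\<lambda>x. \<Sum>w\<in>A. f w * point_mass w x) = f"
  proof
    fix x show "(\<Sum>w\<in>A. f w * point_mass w x) = f x"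
      using fun_cong[OF fun_on_expand[OF assms(2,4)], of x] by (simp only: sum_cscale_apply)
  qed
  ultimately show ?thesis by (simp add: mult.commute)
qed

context periodic_graph
begin

lemma group_G: "group G"
  using group_hom group_hom.axioms(1) by blast

lemma action_closed: "g \<in> carrier G \<Longrightarrow> v \<in> V \<Longrightarrow> \<phi> g v \<in> V"
  by (rule element_image) auto

lemma action_inv_cancel:
  assumes "g \<in> carrier G" "v \<in> V"
  shows "\<phi> (inv g) (\<phi> g v) = v" "\<phi> g (\<phi> (inv g) v) = v"
proof -
  interpret group G by (rule group_G)
  have one: "\<phi> \<one> v = v" using id_eq_one assms(2) by (metis restrict_apply)
  show "\<phi> (inv g) (\<phi> g v) = v"
    using composition_rule[OF assms(2), of "inv g" g] assms(1) one by simp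
  show "\<phi> g (\<phi> (inv g) v) = v"
    using composition_rule[OF assms(2), of g "inv g"] assms(1) one by simp
qed

lemma edge_iff:
  assumes "g \<in> carrier G" "v \<in> V" "w \<in> V"
  shows "(\<phi> g v, \<phi> g w) \<in> E \<longleftrightarrow> (v, w) \<in> E"
proof
  interpret group G by (rule group_G)
  assume "(\<phi> g v, \<phi> g w) \<in> E"
  then have "(\<phi> (inv g) (\<phi> g v), \<phi> (inv g) (\<phi> g w)) \<in> E"
    using edges_preserved assms(1) by simp
  then show "(v, w) \<in> E" using assms by (simp add: action_inv_cancel)
qed (use edges_preserved assms in simp)

lemma vertex_degree_action:
  assumes "g \<in> carrier G" "v \<in> V"
  shows "vertex_degree E (\<phi> g v) = vertex_degree E v"
proof -
  interpret group G by (rule group_G)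
  have "E `` {\<phi> g v} = \<phi> g ` (E `` {v})"
  proof (intro equalityI subsetI)
    fix w assume w: "w \<in> E `` {\<phi> g v}"
    then have "w \<in> V" using edges_in by auto
    then have "w = \<phi> g (\<phi> (inv g) w)" "\<phi> (inv g) w \<in> V"
      using assms(1) by (simp_all add: action_inv_cancel action_closed)
    then show "w \<in> \<phi> g ` (E `` {v})"
      using w edge_iff[OF assms, of "\<phi> (inv g) w"] by (intro image_eqI) auto
  qed (use edges_preserved assms in auto)
  moreover have "inj_on (\<phi> g) (E `` {v})"
    using inj_prop[OF assms(1)] edges_in by (auto intro: inj_on_subset)
  ultimately show ?thesis by (simp add: vertex_degree_def card_image)
qed

lemma finite_walks: "v \<in> V \<Longrightarrow> finite {w. (w, v) \<in> E ^^ n}"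
proof (induction n arbitrary: v)
  case (Suc n)
  have "{w. (w, v) \<in> E ^^ Suc n} \<subseteq> (\<Union>u\<in>E `` {v}. {w. (w, u) \<in> E ^^ n})"
    using undirected by (auto simp: sym_def elim!: relpow_Suc_E)
  moreover have "finite (\<Union>u\<in>E `` {v}. {w. (w, u) \<in> E ^^ n})"
    using Suc locally_finite edges_in by auto
  ultimately show ?case by (rule finite_subset)
qed simp

lemma finite_graph_ball:
  assumes "v \<in> V"
  shows "finite {w. graph_dist E w v < enat \<rho>}"
proof -
  have "{w. graph_dist E w v < enat \<rho>} \<subseteq> (\<Union>n<\<rho>. {w. (w, v) \<in> E ^^ n})"
    by (auto simp: graph_dist_def INF_less_iff)
  then show ?thesis by (rule finite_subset) (use finite_walks[OF assms] in auto)
qed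

definition is_kernel_of :: "('v \<Rightarrow> 'v \<Rightarrow> complex) \<Rightarrow> (('v \<Rightarrow> complex) \<Rightarrow> 'v \<Rightarrow> complex) \<Rightarrow> bool" where
  "is_kernel_of k D \<longleftrightarrow>
     (\<forall>g\<in>carrier G. \<forall>v\<in>V. \<forall>w\<in>V. k (\<phi> g v) (\<phi> g w) = k v w) \<and>
     (\<forall>v\<in>V. finite {w \<in> V. k v w \<noteq> 0}) \<and>
     (\<forall>f\<in>ell2 V. \<forall>v. D f v = (if v \<in> V then \<Sum>w | w \<in> V \<and> k v w \<noteq> 0. k v w * f w else 0))"

lemma laplacian_kernel: "\<exists>k. is_kernel_of k (discrete_laplacian V E)"
proof -
  define s where "s v = complex_of_real (sqrt (real (vertex_degree E v)))" for v
  define k where "k v w = (if (v, w) \<in> E then 1 / (s v * s w) else 0)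
    - (if v = w then of_nat (vertex_degree E v) / (s v * s v) else 0)" for v w
  have "k (\<phi> g v) (\<phi> g w) = k v w" if g: "g \<in> carrier G" "v \<in> V" "w \<in> V" for g v w
  proof -
    have "\<phi> g v = \<phi> g w \<longleftrightarrow> v = w" using inj_prop[OF g(1)] g by (auto simp: inj_on_def)
    then show ?thesis using g by (simp add: k_def s_def edge_iff vertex_degree_action)
  qed
  moreover have fin: "finite (insert v (E `` {v}))" if "v \<in> V" for v
    using locally_finite[OF that] by simp
  moreover have supp: "{w \<in> V. k v w \<noteq> 0} \<subseteq> insert v (E `` {v})" for v
    by (auto simp: k_def split: if_splits)
  moreover have "discrete_laplacian V E f v = (\<Sum>w | w \<in> V \<and> k v w \<noteq> 0. k v w * f w)"
    if v: "v \<in> V" for f v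
  proof -
    have "(\<Sum>w | w \<in> V \<and> k v w \<noteq> 0. k v w * f w) = (\<Sum>w\<in>insert v (E `` {v}). k v w * f w)"
      using v edges_in by (intro sum.mono_neutral_left fin supp) auto
    also have "\<dots> = (\<Sum>w\<in>insert v (E `` {v}). (if (v, w) \<in> E then f w / (s v * s w) else 0))
        - (\<Sum>w\<in>insert v (E `` {v}). (if v = w then of_nat (vertex_degree E v) / (s v * s v) * f w
            else 0))"
      unfolding sum_subtractf[symmetric] by (intro sum.cong) (auto simp: k_def algebra_simps)
    also have "(\<Sum>w\<in>insert v (E `` {v}). (if (v, w) \<in> E then f w / (s v * s w) else 0))
        = (\<Sum>w\<in>E `` {v}. f w / (s v * s w))"
      using fin[OF v] by (intro sum.mono_neutral_cong_right) auto
    also have "(\<Sum>w\<in>insert v (E `` {v}). (if v = w then of_nat (vertex_degree E v) / (s v * s v) *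
        f w else 0))
        = of_nat (vertex_degree E v) / (s v * s v) * f v"
      using fin[OF v] by (simp add: sum.delta)
    also have "(\<Sum>w\<in>E `` {v}. f w / (s v * s w)) - of_nat (vertex_degree E v) / (s v * s v) * f v
        = 1 / s v * (\<Sum>w\<in>E `` {v}. f w / s w - f v / s v)"
      by (simp add: sum_subtractf vertex_degree_def right_diff_distrib sum_distrib_left)
    finally show ?thesis using v by (simp add: discrete_laplacian_def s_def)
  qed
  moreover have "discrete_laplacian V E f v = 0" if "v \<notin> V" for f v
    using that by (simp add: discrete_laplacian_def)
  ultimately have "is_kernel_of k (discrete_laplacian V E)"
    unfolding is_kernel_of_def using finite_subset[OF supp fin] by auto
  then show ?thesis by blast
qed

lemma periodic_operator_kernel:
  assumes lin: "linear_operator_on_ell2 V D" and per: "periodic_operator G V \<phi> D"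
    and ord: "has_order V E D \<rho>"
  shows "is_kernel_of (\<lambda>v w. D (point_mass w) v) D"
proof -
  define N where "N v = {w \<in> V. graph_dist E w v < enat \<rho>}" for v
  have finN: "finite (N v)" if "v \<in> V" for v
    using finite_graph_ball[OF that, of \<rho>] by (auto simp: N_def elim: rev_finite_subset)
  have pm: "point_mass w \<in> ell2 V" if "w \<in> V" for w
    using fun_on_ell2[of "{w}" V] point_mass_fun_on[of w "{w}"] that by auto
  have local: "D f v = (\<Sum>w\<in>N v. D (point_mass w) v * f w)" if f: "f \<in> ell2 V" and v: "v \<in> V" for f v
  proof -
    let ?f = "restrict_support (N v) f"
    have NV: "N v \<subseteq> V" by (auto simp: N_def)
    have f': "?f \<in> fun_on (N v)" by (rule restrict_support_fun_on)
    have "?f \<in> ell2 V" using f' fun_on_ell2[OF finN[OF v] NV] by blast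
    then have "D f v = D ?f v"
      by (intro ord[unfolded has_order_def, rule_format] f v) (simp_all add: restrict_support_def
          N_def)
    also have "\<dots> = (\<Sum>w\<in>N v. D (point_mass w) v * ?f w)"
      by (rule linear_operator_sum[OF lin finN[OF v] NV f'])
    finally show ?thesis by (simp add: restrict_support_def)
  qed
  have supp: "{w \<in> V. D (point_mass w) v \<noteq> 0} \<subseteq> N v" if v: "v \<in> V" for v
  proof
    fix w assume w: "w \<in> {w \<in> V. D (point_mass w) v \<noteq> 0}"
    then have "w \<in> V" "D (point_mass w) v \<noteq> 0" by simp_all
    then have "(\<Sum>u\<in>N v. D (point_mass u) v * point_mass w u) \<noteq> 0"
      by (subst local[OF pm v, symmetric])
    then obtain u where "u \<in> N v" "point_mass w u \<noteq> 0" by (metis (no_types, lifting)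
        mult_zero_right sum.neutral)
    then show "w \<in> N v" by (simp add: point_mass_def split: if_splits)
  qed
  have "D f v = (\<Sum>w | w \<in> V \<and> D (point_mass w) v \<noteq> 0. D (point_mass w) v * f w)"
    if "f \<in> ell2 V" "v \<in> V" for f v
    unfolding local[OF that] by (intro sum.mono_neutral_right finN supp that) (auto simp: N_def)
  moreover have "D f v = 0" if "f \<in> ell2 V" "v \<notin> V" for f v
    by (rule ell2_outside) (use lin that in \<open>auto simp: linear_operator_on_ell2_def\<close>)
  moreover have "D (point_mass (\<phi> g w)) (\<phi> g v) = D (point_mass w) v"
    if g: "g \<in> carrier G" "v \<in> V" "w \<in> V" for g v w
  proof -
    interpret group G by (rule group_G)
    have "translate G V \<phi> g (point_mass w) = point_mass (\<phi> g w)"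
      using g action_inv_cancel action_closed by (auto simp: translate_def point_mass_def
          fun_eq_iff)
    then have "D (point_mass (\<phi> g w)) (\<phi> g v) = translate G V \<phi> g (D (point_mass w)) (\<phi> g v)"
      using per pm[OF g(3)] g(1) unfolding periodic_operator_def by simp
    also have "\<dots> = D (point_mass w) v" using g action_inv_cancel action_closed by (simp add:
        translate_def)
    finally show ?thesis .
  qed
  ultimately show ?thesis
    unfolding is_kernel_of_def using finite_subset[OF supp finN] by auto
qed

end

section \<open>Homomorphisms of free modules over the group algebra\<close>

text \<open>The elements of \<open>R\<^sup>r\<close>, extensional functions from \<open>{..<r}\<close> to the group algebra, are
  identified with the finitely supported functions on \<open>carrier G \<times> {..<r}\<close>.\<close>

definition unflat :: "nat \<Rightarrow> ('g \<times> nat \<Rightarrow> complex) \<Rightarrow> nat \<Rightarrow> 'g \<Rightarrow> complex" where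
  "unflat r x = (\<lambda>i\<in>{..<r}. \<lambda>g. x (g, i))"

definition flat :: "nat \<Rightarrow> (nat \<Rightarrow> 'g \<Rightarrow> complex) \<Rightarrow> 'g \<times> nat \<Rightarrow> complex" where
  "flat r z = (\<lambda>(g, i). if i < r then z i g else 0)"

definition left_mult :: "('g, 'm) monoid_scheme \<Rightarrow> 'g \<Rightarrow> 'g \<times> nat \<Rightarrow> 'g \<times> nat" where
  "left_mult G g = (\<lambda>(h, i). (g \<otimes>\<^bsub>G\<^esub> h, i))"

lemma cscale_point_mass_support: "{k. cscale c (point_mass h) k \<noteq> 0} = (if c = 0 then {} else {h})"
  by (auto simp: point_mass_def)

lemma sum_cscale_point_mass:
  "(\<Sum>k | cscale c (point_mass h) k \<noteq> 0. cscale c (point_mass h) k * F k) = c * F h"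
  unfolding cscale_point_mass_support by (simp add: point_mass_def)

lemma unflat_flat: "z \<in> carrier (free_left_module R r) \<Longrightarrow> unflat r (flat r z) = z"
  by (auto simp: unflat_def flat_def free_left_module_def PiE_def extensional_def fun_eq_iff)

lemma flat_unflat: "x \<in> fin_supp (carrier G \<times> {..<r}) \<Longrightarrow> flat r (unflat r x) = x"
  by (fastforce simp: unflat_def flat_def fin_supp_def)

lemma unflat_closed:
  assumes "x \<in> fin_supp (carrier G \<times> {..<r})"
  shows "unflat r x \<in> carrier (free_left_module (group_algebra G) r)"
proof -
  have "finite {g. x (g, i) \<noteq> 0}" "{g. x (g, i) \<noteq> 0} \<subseteq> carrier G" for i
  proof -
    have "{g. x (g, i) \<noteq> 0} \<subseteq> fst ` {u. x u \<noteq> 0}" by force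
    then show "finite {g. x (g, i) \<noteq> 0}" using assms by (auto simp: fin_supp_def intro:
        finite_subset)
    show "{g. x (g, i) \<noteq> 0} \<subseteq> carrier G" using assms by (auto simp: fin_supp_def)
  qed
  then show ?thesis by (simp add: unflat_def free_left_module_def group_algebra_def)
qed

lemma flat_closed:
  assumes "z \<in> carrier (free_left_module (group_algebra G) r)"
  shows "flat r z \<in> fin_supp (carrier G \<times> {..<r})"
proof -
  have z: "finite {g. z i g \<noteq> 0}" "{g. z i g \<noteq> 0} \<subseteq> carrier G" if "i < r" for i
    using assms that by (auto simp: free_left_module_def group_algebra_def PiE_def)
  have "{u. flat r z u \<noteq> 0} \<subseteq> (\<Union>i<r. (\<lambda>g. (g, i)) ` {g. z i g \<noteq> 0})"
    by (auto simp: flat_def split: if_splits)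
  moreover have "finite (\<Union>i<r. (\<lambda>g. (g, i)) ` {g. z i g \<noteq> 0})" using z by auto
  ultimately have "finite {u. flat r z u \<noteq> 0}" by (rule finite_subset)
  moreover have "g \<in> carrier G" if "i < r" "z i g \<noteq> 0" for i g using z(2)[OF that(1)] that(2) by
      auto
  ultimately show ?thesis by (auto simp: fin_supp_def flat_def split: if_splits)
qed

lemma unflat_image:
  "unflat r ` fin_supp (carrier G \<times> {..<r}) = carrier (free_left_module (group_algebra G) r)"
proof (intro equalityI subsetI)
  fix z assume z: "z \<in> carrier (free_left_module (group_algebra G) r)"
  show "z \<in> unflat r ` fin_supp (carrier G \<times> {..<r})"
    using unflat_flat[OF z, symmetric] flat_closed[OF z] by (rule image_eqI)
qed (use unflat_closed in auto)

lemma unflat_add: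
  "unflat r (x + y) = unflat r x \<oplus>\<^bsub>free_left_module (group_algebra G) r\<^esub> unflat r y"
  by (auto simp: unflat_def free_left_module_def group_algebra_def fun_eq_iff)

lemma flat_add:
  "flat r (x \<oplus>\<^bsub>free_left_module (group_algebra G) r\<^esub> y) = flat r x + flat r y"
  by (auto simp: flat_def free_left_module_def group_algebra_def fun_eq_iff)

lemma flat_zero: "flat r \<zero>\<^bsub>free_left_module (group_algebra G) r\<^esub> = 0"
  by (auto simp: flat_def free_left_module_def group_algebra_def fun_eq_iff)

lemma point_mass_group_algebra:
  "g \<in> carrier G \<Longrightarrow> cscale c (point_mass g) \<in> carrier (group_algebra G)"
  by (simp only: group_algebra_def partial_object.simps mem_Collect_eq cscale_point_mass_support)
      simp

lemma kernel_flat: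
  assumes h: "h \<in> left_module_hom (group_algebra G) (free_left_module (group_algebra G) r) N"
    and fl: "\<And>y. y \<in> carrier N \<Longrightarrow> fl y = 0 \<longleftrightarrow> y = \<zero>\<^bsub>N\<^esub>"
  shows "{x \<in> fin_supp (carrier G \<times> {..<r}). fl (h (unflat r x)) = 0}
    = flat r ` mod_kernel (free_left_module (group_algebra G) r) N h"
proof -
  have hc: "h z \<in> carrier N" if "z \<in> carrier (free_left_module (group_algebra G) r)" for z
    using h that by (auto simp: left_module_hom_def)
  show ?thesis
  proof (intro equalityI subsetI)
    fix x assume "x \<in> {x \<in> fin_supp (carrier G \<times> {..<r}). fl (h (unflat r x)) = 0}"
    then have x: "x \<in> fin_supp (carrier G \<times> {..<r})" "fl (h (unflat r x)) = 0" by simp_all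
    have "unflat r x \<in> mod_kernel (free_left_module (group_algebra G) r) N h"
      using fl[OF hc[OF unflat_closed[OF x(1)]]] x(2) unflat_closed[OF x(1)] by (simp add:
          mod_kernel_def)
    with flat_unflat[OF x(1), symmetric]
    show "x \<in> flat r ` mod_kernel (free_left_module (group_algebra G) r) N h" by (rule image_eqI)
  next
    fix x assume "x \<in> flat r ` mod_kernel (free_left_module (group_algebra G) r) N h"
    then obtain z where z: "x = flat r z" "z \<in> carrier (free_left_module (group_algebra G) r)"
      "h z = \<zero>\<^bsub>N\<^esub>" by (auto simp: mod_kernel_def)
    then show "x \<in> {x \<in> fin_supp (carrier G \<times> {..<r}). fl (h (unflat r x)) = 0}"
      using fl[OF hc[OF z(2)]] flat_closed[OF z(2)] unflat_flat[OF z(2)] by simp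
  qed
qed

context group
begin

lemma group_algebra_mult_point_mass:
  assumes "h \<in> carrier G"
  shows "cscale c (point_mass h) \<otimes>\<^bsub>group_algebra G\<^esub> b
    = (\<lambda>g. if g \<in> carrier G then c * b (inv h \<otimes> g) else 0)"
  unfolding group_algebra_def monoid.simps sum_cscale_point_mass ..

lemma unflat_scale:
  assumes "x \<in> fin_supp (carrier G \<times> {..<r})"
  shows "unflat r (cscale c x) = cscale c (point_mass \<one>) \<odot>\<^bsub>free_left_module (group_algebra G) r\<^esub>
      unflat r x"
proof -
  have "x (g, i) = 0" if "g \<notin> carrier G" for g i using assms that by (auto simp: fin_supp_def)
  then show ?thesis
    unfolding free_left_module_def module.simps group_algebra_mult_point_mass[OF one_closed]
    by (auto simp: unflat_def fun_eq_iff)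
qed

lemma unflat_translate:
  assumes "g \<in> carrier G" "x \<in> fin_supp (carrier G \<times> {..<r})"
  shows "unflat r (translate G (carrier G \<times> {..<r}) (left_mult G) g x)
    = cscale 1 (point_mass g) \<odot>\<^bsub>free_left_module (group_algebra G) r\<^esub> unflat r x"
  unfolding free_left_module_def module.simps group_algebra_mult_point_mass[OF assms(1)]
  by (auto simp: unflat_def translate_def left_mult_def fun_eq_iff)

lemma flat_scale:
  assumes "z \<in> carrier (free_left_module (group_algebra G) r)"
  shows "flat r (cscale c (point_mass \<one>) \<odot>\<^bsub>free_left_module (group_algebra G) r\<^esub> z) = cscale c
      (flat r z)"
proof -
  have "z i g = 0" if "i < r" "g \<notin> carrier G" for i g
    using assms that by (auto simp: free_left_module_def group_algebra_def PiE_def)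
  then show ?thesis
    unfolding free_left_module_def module.simps group_algebra_mult_point_mass[OF one_closed]
    by (auto simp: flat_def fun_eq_iff)
qed

lemma flat_translate:
  assumes "g \<in> carrier G"
  shows "flat r (cscale 1 (point_mass g) \<odot>\<^bsub>free_left_module (group_algebra G) r\<^esub> z)
    = translate G (carrier G \<times> {..<r}) (left_mult G) g (flat r z)"
  unfolding free_left_module_def module.simps group_algebra_mult_point_mass[OF assms]
  by (auto simp: flat_def translate_def left_mult_def fun_eq_iff)

end

lemma (in subexponential_balls) free_gset_left_mult:
  "free_gset G B (carrier G \<times> {..<r}) (left_mult G) ({\<one>} \<times> {..<r})"
proof unfold_locales
  show "\<exists>g\<in>carrier G. \<exists>w\<in>{\<one>} \<times> {..<r}. x = left_mult G g w" if "x \<in> carrier G \<times> {..<r}" for x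
    using that by (intro bexI[of _ "fst x"] bexI[of _ "(\<one>, snd x)"]) (auto simp: left_mult_def)
qed (auto simp: left_mult_def m_assoc)

context free_gset
begin

lemma hom_equivariant_map:
  assumes h: "h \<in> left_module_hom (group_algebra G) (free_left_module (group_algebra G) r) N"
    and fl: "\<And>y. y \<in> carrier N \<Longrightarrow> fl y \<in> fin_supp X"
    and fl_add: "\<And>y z. y \<in> carrier N \<Longrightarrow> z \<in> carrier N \<Longrightarrow> fl (y \<oplus>\<^bsub>N\<^esub> z) = fl y + fl z"
    and fl_scale: "\<And>c y. y \<in> carrier N \<Longrightarrow> fl (cscale c (point_mass \<one>) \<odot>\<^bsub>N\<^esub> y) = cscale c (fl y)"
    and fl_translate: "\<And>g y. g \<in> carrier G \<Longrightarrow> y \<in> carrier N \<Longrightarrow>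
      fl (cscale 1 (point_mass g) \<odot>\<^bsub>N\<^esub> y) = translate G X act g (fl y)"
  shows "equivariant_map G B (carrier G \<times> {..<r}) (left_mult G) ({\<one>} \<times> {..<r}) X act W
    (\<lambda>x. fl (h (unflat r x)))"
proof -
  interpret R: free_gset G B "carrier G \<times> {..<r}" "left_mult G" "{\<one>} \<times> {..<r}"
    by (rule free_gset_left_mult)
  let ?F = "free_left_module (group_algebra G) r"
  have h_closed: "h z \<in> carrier N" if "z \<in> carrier ?F" for z
    using h that by (auto simp: left_module_hom_def)
  have h_add: "h (y \<oplus>\<^bsub>?F\<^esub> z) = h y \<oplus>\<^bsub>N\<^esub> h z" if "y \<in> carrier ?F" "z \<in> carrier ?F" for y z
    using h that by (auto simp: left_module_hom_def)
  have h_smult: "h (a \<odot>\<^bsub>?F\<^esub> z) = a \<odot>\<^bsub>N\<^esub> h z" if "a \<in> carrier (group_algebra G)" "z \<in> carrier ?F"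
      for a z
    using h that by (auto simp: left_module_hom_def)
  show ?thesis
  proof unfold_locales
    fix f assume f: "f \<in> fin_supp (carrier G \<times> {..<r})"
    note uf = unflat_closed[OF f]
    show "fl (h (unflat r f)) \<in> fin_supp X" by (intro fl h_closed uf)
    show "fl (h (unflat r (cscale c f))) = cscale c (fl (h (unflat r f)))" for c
      unfolding unflat_scale[OF f] h_smult[OF point_mass_group_algebra[OF one_closed] uf]
      by (rule fl_scale[OF h_closed[OF uf]])
    show "fl (h (unflat r (f + f'))) = fl (h (unflat r f)) + fl (h (unflat r f'))"
      if "f' \<in> fin_supp (carrier G \<times> {..<r})" for f'
      unfolding unflat_add[of r f f' G] h_add[OF uf unflat_closed[OF that]]
      by (rule fl_add[OF h_closed[OF uf] h_closed[OF unflat_closed[OF that]]])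
    show "fl (h (unflat r (translate G (carrier G \<times> {..<r}) (left_mult G) g f)))
        = translate G X act g (fl (h (unflat r f)))" if "g \<in> carrier G" for g
      unfolding unflat_translate[OF that f] h_smult[OF point_mass_group_algebra[OF that] uf]
      by (rule fl_translate[OF that h_closed[OF uf]])
  qed
qed

end

section \<open>Counting dimensions along a resolution\<close>

lemma alternating_sum_estimate:
  fixes u :: "nat \<Rightarrow> real"
  assumes "\<And>k. k \<le> d \<Longrightarrow> \<bar>u k + u (Suc k) - r k * b\<bar> \<le> c" and "u (Suc d) = 0"
  shows "\<bar>(\<Sum>k\<le>d. (-1) ^ k * r k) * b - u 0\<bar> \<le> real (Suc d) * c"
proof -
  have telescope: "(\<Sum>k\<le>n. (-1) ^ k * (u k + u (Suc k))) = u 0 + (-1) ^ n * u (Suc n)" for n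
  proof (induction n)
    case (Suc n)
    have "(-1::real) ^ Suc n = - ((-1) ^ n)" by simp
    then show ?case unfolding sum.atMost_Suc Suc.IH by (simp only:) (simp add: distrib_left)
  qed simp
  let ?S = "\<Sum>k\<le>d. (-1) ^ k * (u k + u (Suc k) - r k * b)"
  have "?S = (\<Sum>k\<le>d. (-1) ^ k * (u k + u (Suc k))) - (\<Sum>k\<le>d. (-1) ^ k * r k) * b"
    unfolding sum_distrib_right sum_subtractf[symmetric]
    by (rule sum.cong) (simp_all add: right_diff_distrib mult.assoc)
  also have "\<dots> = u 0 - (\<Sum>k\<le>d. (-1) ^ k * r k) * b"
    unfolding telescope assms(2) by simp
  finally have "\<bar>(\<Sum>k\<le>d. (-1) ^ k * r k) * b - u 0\<bar> = \<bar>?S\<bar>" by linarith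
  also have "\<dots> \<le> (\<Sum>k\<le>d. \<bar>(-1) ^ k * (u k + u (Suc k) - r k * b)\<bar>)" by (rule sum_abs)
  also have "\<dots> \<le> (\<Sum>k\<le>d. c)"
    using assms(1) by (intro sum_mono) (simp add: abs_mult power_abs)
  finally show ?thesis by simp
qed

context free_gset
begin

lemma resolution_estimate:
  assumes res: "finite_free_resolution (group_algebra G) N d r \<epsilon> \<delta>"
    and N: "carrier N \<subseteq> fin_supp X" "\<zero>\<^bsub>N\<^esub> = 0"
    and N_add: "\<And>y z. y \<in> carrier N \<Longrightarrow> z \<in> carrier N \<Longrightarrow> y \<oplus>\<^bsub>N\<^esub> z = y + z"
    and N_scale: "\<And>c y. y \<in> carrier N \<Longrightarrow> cscale c (point_mass \<one>) \<odot>\<^bsub>N\<^esub> y = cscale c y"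
    and N_translate: "\<And>g y. g \<in> carrier G \<Longrightarrow> y \<in> carrier N \<Longrightarrow>
      cscale 1 (point_mass g) \<odot>\<^bsub>N\<^esub> y = translate G X act g y"
  obtains m C where "\<And>n. \<bar>(\<Sum>k\<le>d. (-1) ^ k * real (r k)) * real (card (B n))
      - real (cfun.dim (carrier N \<inter> fun_on (box n)))\<bar>
    \<le> C * (real (card (B (n + m))) - real (card (B n)))"
proof -
  let ?A = "group_algebra G"
  let ?F = "\<lambda>k. free_left_module ?A (r k)"
  let ?X = "\<lambda>k. carrier G \<times> {..<r k}"
  let ?b = "\<lambda>n. real (card (B n))"
  define incoming where "incoming k = (if k < d then \<delta> k ` carrier (?F (Suc k)) else {\<zero>\<^bsub>?F k\<^esub>})"
      for k
  have \<epsilon>: "\<epsilon> \<in> left_module_hom ?A (?F 0) N" "\<epsilon> ` carrier (?F 0) = carrier N"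
    "mod_kernel (?F 0) N \<epsilon> = incoming 0"
    and \<delta>: "\<And>k. k < d \<Longrightarrow> \<delta> k \<in> left_module_hom ?A (?F (Suc k)) (?F k)"
    "\<And>k. k < d \<Longrightarrow> mod_kernel (?F (Suc k)) (?F k) (\<delta> k) = incoming (Suc k)"
    using res unfolding finite_free_resolution_def Let_def incoming_def by blast+
  interpret M: free_gset G B "?X k" "left_mult G" "{\<one>} \<times> {..<r k}" for k
    by (rule free_gset_left_mult)
  define u where "u k n = (case k of 0 \<Rightarrow> real (cfun.dim (carrier N \<inter> fun_on (box n)))
      | Suc j \<Rightarrow> real (cfun.dim (flat (r j) ` incoming j \<inter> fun_on (M.box j n))))" for k n
  have u_last: "u (Suc d) n = 0" for n
  proof -
    have "flat (r d) ` incoming d \<inter> fun_on (M.box d n) \<subseteq> fun_on {}"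
      by (auto simp: incoming_def flat_zero fun_on_def)
    then have "cfun.dim (flat (r d) ` incoming d \<inter> fun_on (M.box d n)) \<le> card ({} :: ('g \<times> nat)
        set)"
      by (rule dim_le_card) simp
    then show ?thesis by (simp add: u_def)
  qed
  have est: "\<exists>m c. \<forall>n. \<bar>u k n + u (Suc k) n - real (r k) * ?b n\<bar> \<le> real c * (?b (n + m) - ?b n)"
      if "k \<le> d" for k
  proof (cases k)
    case 0
    have T: "equivariant_map G B (?X 0) (left_mult G) ({\<one>} \<times> {..<r 0}) X act W (\<lambda>x. \<epsilon> (unflat (r
        0) x))"
      by (rule hom_equivariant_map[OF \<epsilon>(1), where fl = "\<lambda>y. y"]) (use N N_add N_scale N_translate
          in auto)
    have img: "(\<lambda>x. \<epsilon> (unflat (r 0) x)) ` fin_supp (?X 0) = carrier N"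
      using \<epsilon>(2) unflat_image[of "r 0" G] by (metis image_image)
    have ker: "{x \<in> fin_supp (?X 0). \<epsilon> (unflat (r 0) x) = 0} = flat (r 0) ` incoming 0"
      using kernel_flat[OF \<epsilon>(1), of "\<lambda>y. y"] N(2) \<epsilon>(3) by simp
    obtain m where "\<And>n. \<bar>real (cfun.dim (carrier N \<inter> fun_on (box n)))
        + real (cfun.dim (flat (r 0) ` incoming 0 \<inter> fun_on (M.box 0 n))) - card ({\<one>} \<times> {..<r 0})
            * ?b n\<bar>
      \<le> (card ({\<one>} \<times> {..<r 0}) + card W) * (?b (n + m) - ?b n)"
      using equivariant_map.dim_image_kernel[OF T] unfolding img ker by blast
    then show ?thesis by (intro exI[of _ m] exI[of _ "r 0 + card W"]) (simp add: 0 u_def)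
  next
    case (Suc j)
    then have j: "j < d" using that by simp
    let ?T = "\<lambda>x. flat (r j) (\<delta> j (unflat (r (Suc j)) x))"
    have T: "equivariant_map G B (?X (Suc j)) (left_mult G) ({\<one>} \<times> {..<r (Suc j)})
      (?X j) (left_mult G) ({\<one>} \<times> {..<r j}) ?T"
    proof (rule M.hom_equivariant_map[OF \<delta>(1)[OF j], where fl = "flat (r j)"])
      show "flat (r j) y \<in> fin_supp (?X j)" if "y \<in> carrier (?F j)" for y
        by (rule flat_closed[OF that])
      show "flat (r j) (y \<oplus>\<^bsub>?F j\<^esub> z) = flat (r j) y + flat (r j) z" for y z
        by (rule flat_add)
      show "flat (r j) (cscale c (point_mass \<one>) \<odot>\<^bsub>?F j\<^esub> y) = cscale c (flat (r j) y)"
        if "y \<in> carrier (?F j)" for c y by (rule flat_scale[OF that])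
      show "flat (r j) (cscale 1 (point_mass g) \<odot>\<^bsub>?F j\<^esub> y) = translate G (?X j) (left_mult G) g
          (flat (r j) y)"
        if "g \<in> carrier G" for g y by (rule flat_translate[OF that])
    qed
    have img: "?T ` fin_supp (?X (Suc j)) = flat (r j) ` incoming j"
      using j by (simp add: incoming_def unflat_image[of "r (Suc j)" G, symmetric] image_image)
    have "flat (r j) y = 0 \<longleftrightarrow> y = \<zero>\<^bsub>?F j\<^esub>" if "y \<in> carrier (?F j)" for y
    proof
      assume "flat (r j) y = 0"
      then have "flat (r j) y = flat (r j) \<zero>\<^bsub>?F j\<^esub>" by (simp only: flat_zero)
      moreover have "\<zero>\<^bsub>?F j\<^esub> \<in> carrier (?F j)"
        by (simp add: free_left_module_def group_algebra_def)
      ultimately show "y = \<zero>\<^bsub>?F j\<^esub>" using unflat_flat that by metis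
    qed (simp only: flat_zero)
    then have ker: "{x \<in> fin_supp (?X (Suc j)). ?T x = 0} = flat (r (Suc j)) ` incoming (Suc j)"
      using kernel_flat[OF \<delta>(1)[OF j], of "flat (r j)"] \<delta>(2)[OF j] by simp
    obtain m where "\<And>n. \<bar>real (cfun.dim (flat (r j) ` incoming j \<inter> fun_on (M.box j n)))
        + real (cfun.dim (flat (r (Suc j)) ` incoming (Suc j) \<inter> fun_on (M.box (Suc j) n)))
        - card ({\<one>} \<times> {..<r (Suc j)}) * ?b n\<bar>
      \<le> (card ({\<one>} \<times> {..<r (Suc j)}) + card ({\<one>} \<times> {..<r j})) * (?b (n + m) - ?b n)"
      using equivariant_map.dim_image_kernel[OF T] unfolding img ker by blast
    then show ?thesis by (intro exI[of _ m] exI[of _ "r (Suc j) + r j"]) (simp add: Suc u_def)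
  qed
  then obtain mk ck where mk: "\<And>k n. k \<le> d \<Longrightarrow>
      \<bar>u k n + u (Suc k) n - real (r k) * ?b n\<bar> \<le> real (ck k) * (?b (n + mk k) - ?b n)"
    by metis
  define m where "m = (\<Sum>k\<le>d. mk k)"
  define c where "c = (\<Sum>k\<le>d. ck k)"
  have "\<bar>u k n + u (Suc k) n - real (r k) * ?b n\<bar> \<le> real c * (?b (n + m) - ?b n)" if k: "k \<le> d"
      for k n
  proof -
    have "mk k \<le> m" "ck k \<le> c" using k by (auto simp: m_def c_def intro!: member_le_sum)
    moreover have "?b n \<le> ?b (n + mk k)" "?b (n + mk k) \<le> ?b (n + m)"
      using card_mono[OF B_finite B_mono] \<open>mk k \<le> m\<close> by simp_all
    ultimately have "real (ck k) * (?b (n + mk k) - ?b n) \<le> real c * (?b (n + m) - ?b n)"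
      by (intro mult_mono) auto
    then show ?thesis using mk[OF k, of n] by linarith
  qed
  then have "\<bar>(\<Sum>k\<le>d. (-1) ^ k * real (r k)) * ?b n - u 0 n\<bar> \<le> real (Suc d) * (real c * (?b (n +
      m) - ?b n))" for n
    by (rule alternating_sum_estimate[of d "\<lambda>k. u k n"]) (auto simp: u_last)
  then show ?thesis using that[of "real (Suc d) * real c" m] by (simp add: u_def mult.assoc)
qed

end

section \<open>Eigenfunctions of periodic operators\<close>

context periodic_graph
begin

lemma fundamental_domain_card:
  assumes "fundamental_domain G V \<phi> W"
  shows "finite W" and "card W = card (orbits G V \<phi>)"
proof -
  have W: "W \<subseteq> V" "\<And>Q. Q \<in> orbits G V \<phi> \<Longrightarrow> \<exists>!w. w \<in> W \<inter> Q"
    using assms by (auto simp: fundamental_domain_def)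
  have orb: "orbit G \<phi> w \<in> orbits G V \<phi>" if "w \<in> V" for w using that by (auto simp: orbits_def)
  have "bij_betw (orbit G \<phi>) W (orbits G V \<phi>)"
  proof (rule bij_betw_imageI)
    show "inj_on (orbit G \<phi>) W"
    proof (rule inj_onI)
      fix v w assume vw: "v \<in> W" "w \<in> W" "orbit G \<phi> v = orbit G \<phi> w"
      then have "v \<in> W \<inter> orbit G \<phi> w" "w \<in> W \<inter> orbit G \<phi> w" using orbit_refl W(1) by blast+
      then show "v = w" using W(2)[OF orb[of w]] vw W(1) by blast
    qed
    show "orbit G \<phi> ` W = orbits G V \<phi>"
    proof (intro equalityI subsetI)
      fix Q assume Q: "Q \<in> orbits G V \<phi>"
      then obtain v where v: "v \<in> V" "Q = orbit G \<phi> v" by (auto simp: orbits_def)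
      obtain w where w: "w \<in> W" "w \<in> Q" using W(2)[OF Q] by blast
      then have "orbit G \<phi> w = Q"
        using disjoint_union[OF orb[of w] Q] orbit_refl[of w] W(1) by blast
      then show "Q \<in> orbit G \<phi> ` W" using w by blast
    qed (use orb W in auto)
  qed
  then show "finite W" "card W = card (orbits G V \<phi>)"
    using finitely_many_orbits bij_betw_finite bij_betw_same_card by blast+
qed

lemma free_gset_vertices:
  assumes "subexponential_balls G B" "fundamental_domain G V \<phi> W"
  shows "free_gset G B V \<phi> W"
proof -
  interpret subexponential_balls G B by (rule assms(1))
  have W: "W \<subseteq> V" "\<And>Q. Q \<in> orbits G V \<phi> \<Longrightarrow> \<exists>!w. w \<in> W \<inter> Q"
    using assms(2) by (auto simp: fundamental_domain_def)
  have orb: "orbit G \<phi> w \<in> orbits G V \<phi>" if "w \<in> V" for w using that by (auto simp: orbits_def)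
  show ?thesis
  proof unfold_locales
    show "\<phi> \<one> v = v" if "v \<in> V" for v using id_eq_one that by (metis restrict_apply)
    show "\<phi> g v \<in> V" if "g \<in> carrier G" "v \<in> V" for g v by (rule action_closed[OF that])
    show "\<phi> (g \<otimes> h) v = \<phi> g (\<phi> h v)" if "g \<in> carrier G" "h \<in> carrier G" "v \<in> V" for g h v
      by (rule composition_rule[OF that(3,1,2)])
    show "W \<subseteq> V" by (rule W(1))
    show "finite W" by (rule fundamental_domain_card[OF assms(2)])
    show "\<exists>g\<in>carrier G. \<exists>w\<in>W. v = \<phi> g w" if v: "v \<in> V" for v
    proof -
      obtain w where w: "w \<in> W" "w \<in> orbit G \<phi> v" using W(2)[OF orb[OF v]] by blast
      then obtain g where g: "g \<in> carrier G" "w = \<phi> g v" by (auto simp: orbit_def)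
      then have "v = \<phi> (inv g) w" using v by (simp add: action_inv_cancel)
      then show ?thesis using g w by (intro bexI[of _ "inv g"] bexI[of _ w]) auto
    qed
    show "g = h \<and> w = w'"
      if gh: "g \<in> carrier G" "h \<in> carrier G" "w \<in> W" "w' \<in> W" "\<phi> g w = \<phi> h w'" for g h w w'
    proof -
      have V: "w \<in> V" "w' \<in> V" using gh W(1) by auto
      have e: "\<phi> (inv h \<otimes> g) w = w'"
        using composition_rule[OF V(1), of "inv h" g] gh V by (simp add: action_inv_cancel)
      then have "w' \<in> orbit G \<phi> w" using gh by (auto simp: orbit_def intro!: exI[of _ "inv h \<otimes> g"])
      then have "w = w'" using W(2)[OF orb[OF V(1)]] gh orbit_refl[OF V(1)] by blast
      then have "inv h \<otimes> g = \<one>" using free_action[of "inv h \<otimes> g" w] e gh V by simp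
      then have "g = h" using gh by (metis inv_equality inv_inv inv_closed)
      then show ?thesis using \<open>w = w'\<close> by simp
    qed
  qed
qed

end

theorem theorem6p3:
  fixes G :: "('g, 'm) monoid_scheme"
    and V :: "'v set"
    and \<phi> :: "'g \<Rightarrow> 'v \<Rightarrow> 'v"
    and E :: "('v \<times> 'v) set"
    and D :: "('v \<Rightarrow> complex) \<Rightarrow> 'v \<Rightarrow> complex"
    and \<mu> :: complex
    and W :: "'v set"
    and d :: nat
    and r :: "nat \<Rightarrow> nat"
  assumes "finitely_generated G"
    and "subexponential_growth G"
    and "periodic_graph G V \<phi> E"
    and "D = discrete_laplacian V E \<or>
         (linear_operator_on_ell2 V D \<and> periodic_operator G V \<phi> D \<and> finite_order V E D)"
    and "is_eigenvalue V D \<mu>"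
    and "fundamental_domain G V \<phi> W"
    and "\<exists>\<epsilon> \<delta>. finite_free_resolution (group_algebra G)
                  (eigenfunction_module G V \<phi> D \<mu>) d r \<epsilon> \<delta>"
  shows "density_of_states_at V W D \<mu> =
         1 / of_nat (card (orbits G V \<phi>)) * (\<Sum>k\<le>d. (-1) ^ k * of_nat (r k))"
proof -
  interpret periodic_graph G V \<phi> E by (rule assms(3))
  interpret group G by (rule group_G)
  obtain B where B: "subexponential_balls G B"
    by (rule subexponential_balls_exist[OF assms(2)])
  interpret free_gset G B V \<phi> W by (rule free_gset_vertices[OF B assms(6)])
  obtain k where k: "is_kernel_of k D"
    using assms(4) laplacian_kernel periodic_operator_kernel unfolding finite_order_def by blast
  define a where "a v w = k v w - (if v = w then \<mu> else 0)" for v w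
  have supp: "{w \<in> V. a v w \<noteq> 0} \<subseteq> insert v {w \<in> V. k v w \<noteq> 0}" for v
    by (auto simp: a_def split: if_splits)
  have fin: "finite (insert v {w \<in> V. k v w \<noteq> 0})" if "v \<in> V" for v
    using k that by (simp add: is_kernel_of_def)
  interpret local_kernel G B V \<phi> W a
  proof unfold_locales
    show "a (\<phi> g v) (\<phi> g w) = a v w" if "g \<in> carrier G" "v \<in> V" "w \<in> V" for g v w
    proof -
      have "\<phi> g v = \<phi> g w \<longleftrightarrow> v = w" using inj_prop[OF that(1)] that by (auto simp: inj_on_def)
      then show ?thesis using k that by (simp add: is_kernel_of_def a_def)
    qed
    show "finite {w \<in> V. a v w \<noteq> 0}" if "v \<in> V" for v
      by (rule finite_subset[OF supp fin[OF that]])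
  qed
  have D_apply: "apply_kernel f v = D f v - \<mu> * f v" if f: "f \<in> ell2 V" and v: "v \<in> V" for f v
  proof -
    let ?A = "insert v {w \<in> V. k v w \<noteq> 0}"
    have "apply_kernel f v = (\<Sum>w\<in>?A. a v w * f w)"
      unfolding apply_kernel_def using v by (intro sum.mono_neutral_left fin supp) auto
    also have "\<dots> = (\<Sum>w\<in>?A. k v w * f w) - (\<Sum>w\<in>?A. (if v = w then \<mu> * f w else 0))"
      unfolding sum_subtractf[symmetric] by (rule sum.cong) (auto simp: a_def algebra_simps)
    also have "(\<Sum>w\<in>?A. (if v = w then \<mu> * f w else 0)) = \<mu> * f v"
      using fin[OF v] by (simp add: sum.delta)
    also have "(\<Sum>w\<in>?A. k v w * f w) = (\<Sum>w | w \<in> V \<and> k v w \<noteq> 0. k v w * f w)"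
      using fin[OF v] v by (intro sum.mono_neutral_right) auto
    also have "\<dots> = D f v" using k f v by (simp add: is_kernel_of_def)
    finally show ?thesis .
  qed
  have D_outside: "D f v = 0" if "f \<in> ell2 V" "v \<notin> V" for f v
    using k that by (simp add: is_kernel_of_def)
  have eigen_iff: "D f = (\<lambda>v. \<mu> * f v) \<longleftrightarrow> f \<in> ker2" if f: "f \<in> ell2 V" for f
  proof
    assume "D f = (\<lambda>v. \<mu> * f v)"
    then show "f \<in> ker2" using f D_apply[OF f] by (simp add: ker2_def)
  next
    assume f2: "f \<in> ker2"
    show "D f = (\<lambda>v. \<mu> * f v)"
    proof
      fix v show "D f v = \<mu> * f v"
        using f2 D_apply[OF f, of v] D_outside[OF f, of v] ell2_outside[OF f, of v]
        by (cases "v \<in> V") (auto simp: ker2_def)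
    qed
  qed
  have eigenspace: "eigenspace V D \<mu> = ker2"
    using eigen_iff ker2_ell2 by (auto simp: eigenspace_def)
  let ?K = "eigenfunction_module G V \<phi> D \<mu>"
  have fs: "fin_supp V \<subseteq> ell2 V"
    using fun_on_ell2[of "{v. f v \<noteq> 0}" V for f] by (fastforce simp: fin_supp_def fun_on_def)
  have K: "carrier ?K = ker2 \<inter> fin_supp V"
    using eigen_iff fs by (auto simp: eigenfunction_module_def fin_supp_def[symmetric] simp flip:
        conj_assoc) (auto simp: fin_supp_def)
  obtain p where p: "reproducing_kernel V ker2 p" by (rule reproducing_kernel_exists)
  interpret reproducing_kernel V ker2 p by (rule p)
  define \<tau> where "\<tau> = (\<Sum>w\<in>W. Re (p w w))"
  have "(\<Sum>w\<in>W. p w w) = complex_of_real \<tau>"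
  proof -
    have "p w w = complex_of_real (Re (p w w))" if "w \<in> W" for w
      using sqnorm_kernel[of w] that W_subset by (metis Re_complex_of_real subsetD)
    then show ?thesis unfolding \<tau>_def of_real_sum by (intro sum.cong) auto
  qed
  then have dos: "density_of_states_at V W D \<mu> = 1 / of_nat (card W) * complex_of_real \<tau>"
    unfolding density_of_states_at_def eigenspace
    using operator_trace_projection[OF W_finite W_subset] by simp
  obtain m where m: "\<And>n. \<bar>\<tau> * real (card (B n)) - real (cfun.dim (ker2 \<inter> fun_on (box n)))\<bar>
      \<le> card W * (real (card (B (n + m))) - real (card (B n)))"
    unfolding \<tau>_def by (rule density_estimate[OF p]) blast
  obtain \<epsilon> \<delta> where res: "finite_free_resolution (group_algebra G) ?K d r \<epsilon> \<delta>"
    using assms(7) by blast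
  define \<chi> where "\<chi> = (\<Sum>k\<le>d. (-1) ^ k * real (r k))"
  have one_translate: "translate G V \<phi> \<one>\<^bsub>G\<^esub> f = f" if "f \<in> fin_supp V" for f
    using that act_one by (auto simp: translate_def fin_supp_def fun_eq_iff)
  obtain m' C where m': "\<And>n. \<bar>\<chi> * real (card (B n)) - real (cfun.dim (carrier ?K \<inter> fun_on (box n)))\<bar>
      \<le> C * (real (card (B (n + m'))) - real (card (B n)))"
    unfolding \<chi>_def
  proof (rule resolution_estimate[OF res])
    show "carrier ?K \<subseteq> fin_supp V" by (simp add: K)
    show "\<zero>\<^bsub>?K\<^esub> = 0" by (simp add: eigenfunction_module_def zero_fun_def)
    show "y \<oplus>\<^bsub>?K\<^esub> z = y + z" for y z by (simp add: eigenfunction_module_def plus_fun_def)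
    show "cscale c (point_mass \<one>\<^bsub>G\<^esub>) \<odot>\<^bsub>?K\<^esub> y = cscale c y" if "y \<in> carrier ?K" for c y
    proof -
      have "translate G V \<phi> \<one>\<^bsub>G\<^esub> y = y" using that K by (intro one_translate) auto
      then show ?thesis
        by (simp only: eigenfunction_module_def module.simps sum_cscale_point_mass)
          (simp add: cscale_def)
    qed
    show "cscale 1 (point_mass g) \<odot>\<^bsub>?K\<^esub> y = translate G V \<phi> g y" for g y
      by (simp only: eigenfunction_module_def module.simps sum_cscale_point_mass) simp
  qed blast
  have "carrier ?K \<inter> fun_on (box n) = ker2 \<inter> fun_on (box n)" for n
    using fin_supp_iff K by blast
  then have est: "\<bar>\<tau> - \<chi>\<bar> * real (card (B n))
      \<le> (real (card W) + \<bar>C\<bar>) * (real (card (B (n + (m + m')))) - real (card (B n)))" for n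
  proof -
    let ?b = "\<lambda>n. real (card (B n))" and ?D = "real (cfun.dim (ker2 \<inter> fun_on (box n)))"
    have b: "?b n \<le> ?b (n + m)" "?b n \<le> ?b (n + m')" "?b (n + m) \<le> ?b (n + (m + m'))"
      "?b (n + m') \<le> ?b (n + (m + m'))"
      using card_mono[OF B_finite B_mono] by simp_all
    have "\<bar>\<tau> - \<chi>\<bar> * ?b n = \<bar>(\<tau> * ?b n - ?D) - (\<chi> * ?b n - ?D)\<bar>"
      by (simp add: left_diff_distrib[symmetric] abs_mult)
    also have "\<dots> \<le> \<bar>\<tau> * ?b n - ?D\<bar> + \<bar>\<chi> * ?b n - ?D\<bar>" by (rule abs_triangle_ineq4)
    also have "\<dots> \<le> card W * (?b (n + m) - ?b n) + C * (?b (n + m') - ?b n)"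
      using m[of n] m'[of n] \<open>\<And>n. carrier ?K \<inter> fun_on (box n) = ker2 \<inter> fun_on (box n)\<close> by simp
    also have "\<dots> \<le> card W * (?b (n + (m + m')) - ?b n) + \<bar>C\<bar> * (?b (n + (m + m')) - ?b n)"
      using b by (intro add_mono mult_mono) auto
    finally show ?thesis by (simp add: distrib_right)
  qed
  have "\<tau> = \<chi>" by (rule eq_of_boundary_estimate[OF est])
  moreover have "complex_of_real \<chi> = (\<Sum>k\<le>d. (-1) ^ k * of_nat (r k))" by (simp add: \<chi>_def)
  ultimately show ?thesis using dos fundamental_domain_card(2)[OF assms(6)] by simp
qed

end
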